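(* Let $f:\mathbb R\to\mathbb R$ be a smooth function that does not satisfy any linear second order ODE, i.e. such that $f$, $f_u$ and $f_{uu}$ are linearly independent over $\mathbb R$. Then $V_d=0$ for all integers $d$ with $|d|\ge2$, i.e. no higher-order conservation laws occur (that is, $\mathcal C=\mathcal C_{(0)}$).
   Context: The underlying PDE is $u_{z\bar z}=-f(u)$ for $u:\mathbb C\to\mathbb R$. Subscripts such as $f_u$, $A_{u_i}$ denote partial derivatives; bars denote complex conjugation. For $k\ge 0$ let $M^{(k)}=\mathbb C^{k+2}\times\mathbb R$ with complex coordinates $z,u_0,\dots,u_k$ and real coordinate $u$. Let $M^{(\infty)}$ be the inverse limit of the projections $M^{(k+1)}\to M^{(k)}$ forgetting $u_{k+1}$; smooth functions and differential forms on $M^{(\infty)}$ are by definition pullbacks of such objects from some $M^{(k)}$. Put $T^0=f(u)$, $T^{i+1}=\sum_{j=0}^{i}\binom ij u_{i-j}\,T^j_u$, and $\zeta=dz$, $\eta_0=du-u_0\zeta-\bar u_0\bar\zeta$, $\omega_{i+1}=du_i+T^i\bar\zeta$, $\eta_{i+1}=\omega_{i+1}-u_{i+1}\zeta$ ($i\ge0$), $\psi=\operatorname{Im}(\zeta\wedge\omega_1)$. Let $\mathcal I^{(\infty)}$ be the differential ideal on $M^{(\infty)}$ generated by $\eta_0,\eta_i,\bar\eta_i$ ($i\ge1$). Let $e_{-1}=\partial_z+u_0\partial_u+\sum_{i\ge0}u_{i+1}\partial_{u_i}-\sum_{i\ge0}\overline{T^i}\,\partial_{\bar u_i}$ and $e_{\overline{-1}}=\overline{e_{-1}}$.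 A complex function $P$ on $M^{(\infty)}$ has weighted degree $d\in\mathbb Z$ if $P(u,\lambda^{-1}z,(\lambda^{j+1}u_j)_j)=\lambda^dP(u,z,(u_j)_j)$ for all $\lambda\in\mathbb C$ with $|\lambda|=1$. $V_d$ is the complex vector space of complex-valued functions $P$ on $M^{(\infty)}$ of weighted degree $d$ satisfying $e_{\overline{-1}}e_{-1}P+f_uP=0$, $P_u=0$ and $P_{u_i\bar u_j}=0$ for all $i,j\ge0$. $\mathcal C$ (representatives of differentiated conservation laws in normal form) is the real vector space of closed real $2$-forms $\Phi\in\mathcal I^{(\infty)}$ on $M^{(\infty)}$ of the form $\Phi=\eta_0\wedge\rho+A\psi+\sum_{1\le i<j\le k}(B^{ij}\eta_i\wedge\eta_j+\overline{B^{ij}}\bar\eta_i\wedge\bar\eta_j)+\sum_{1\le i\le j\le k}(D^{ij}\eta_i\wedge\bar\eta_j+\overline{D^{ij}}\bar\eta_i\wedge\eta_j)$ for some $k$, some $1$-form $\rho$, and some functions $A,B^{ij},D^{ij}$ with $A$ real. $\mathcal C_{(k)}\subset\mathcal C$ is the subspace of those elements defined on $M^{(k)}$. Elements of $\mathcal C_{(0)}$ are the classical conservation laws; a conservation law in normal form that is not in $\mathcal C_{(0)}$ is called higher-order. *)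

theory Defs
  imports "HOL-Analysis.Analysis" "HOL-Library.Function_Algebras"
begin

section \<open>The spaces $M^{(k)}$ and $M^{(\infty)}$\<close>

text \<open>
  A point of the inverse limit $M^{(\infty)}$ is a triple $(z, u, (u_j)_{j \ge 0})$; the product
  topology on this type is the inverse limit topology. An object on $M^{(k)}$ is represented by its
  pullback to $M^{(\infty)}$, so that all the pullback maps are inclusions.
\<close>

type_synonym jet = "complex \<times> real \<times> (nat \<Rightarrow> complex)"

definition z_of :: "jet \<Rightarrow> complex" where "z_of p = fst p"
definition u_of :: "jet \<Rightarrow> real" where "u_of p = fst (snd p)"
definition uj_of :: "nat \<Rightarrow> jet \<Rightarrow> complex" where "uj_of j p = snd (snd p) j"

datatype real_coord = ReZ | ImZ | RealU | ReUj nat | ImUj nat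

fun translate :: "real_coord \<Rightarrow> real \<Rightarrow> jet \<Rightarrow> jet" where
  "translate ReZ t (z, u, w) = (z + of_real t, u, w)"
| "translate ImZ t (z, u, w) = (z + \<i> * of_real t, u, w)"
| "translate RealU t (z, u, w) = (z, u + t, w)"
| "translate (ReUj j) t (z, u, w) = (z, u, w(j := w j + of_real t))"
| "translate (ImUj j) t (z, u, w) = (z, u, w(j := w j + \<i> * of_real t))"

definition real_partial :: "real_coord \<Rightarrow> (jet \<Rightarrow> complex) \<Rightarrow> jet \<Rightarrow> complex" where
  "real_partial c F p = vector_derivative (\<lambda>t. F (translate c t p)) (at 0)"

text \<open>
  Smooth functions on $M^{(k)}$: they do not involve $u_j$ for $j > k$, and all their iterated
  partial derivatives with respect to the real coordinates exist and are continuous.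
\<close>

definition smooth_fun_on :: "nat \<Rightarrow> (jet \<Rightarrow> complex) \<Rightarrow> bool" where
  "smooth_fun_on k F \<longleftrightarrow>
     (\<forall>z u v w. (\<forall>j\<le>k. v j = w j) \<longrightarrow> F (z, u, v) = F (z, u, w)) \<and>
     (\<forall>cs. continuous_on UNIV (foldr real_partial cs F) \<and>
        (\<forall>c p. (\<lambda>t. foldr real_partial cs F (translate c t p)) differentiable (at 0)))"

definition smooth_fun :: "(jet \<Rightarrow> complex) \<Rightarrow> bool" where
  "smooth_fun F \<longleftrightarrow> (\<exists>k. smooth_fun_on k F)"

text \<open>
  The coordinate frame $\partial_z, \partial_{\bar z}, \partial_u, \partial_{u_j},
  \partial_{\bar u_j}$ of the complexified tangent bundle.
\<close>

datatype coord = Z | Zbar | U | Uj nat | Ujbar nat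

fun conj_coord :: "coord \<Rightarrow> coord" where
  "conj_coord Z = Zbar"
| "conj_coord Zbar = Z"
| "conj_coord U = U"
| "conj_coord (Uj j) = Ujbar j"
| "conj_coord (Ujbar j) = Uj j"

fun coord_on :: "nat \<Rightarrow> coord \<Rightarrow> bool" where
  "coord_on k (Uj j) \<longleftrightarrow> j \<le> k"
| "coord_on k (Ujbar j) \<longleftrightarrow> j \<le> k"
| "coord_on k _ \<longleftrightarrow> True"

fun partial :: "coord \<Rightarrow> (jet \<Rightarrow> complex) \<Rightarrow> jet \<Rightarrow> complex" where
  "partial Z F p = (real_partial ReZ F p - \<i> * real_partial ImZ F p) / 2"
| "partial Zbar F p = (real_partial ReZ F p + \<i> * real_partial ImZ F p) / 2"
| "partial U F p = real_partial RealU F p"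
| "partial (Uj j) F p = (real_partial (ReUj j) F p - \<i> * real_partial (ImUj j) F p) / 2"
| "partial (Ujbar j) F p = (real_partial (ReUj j) F p + \<i> * real_partial (ImUj j) F p) / 2"


section \<open>Complex differential forms\<close>

text \<open>
  A (possibly inhomogeneous) form is given by its coefficients in the complex coordinate frame:
  \<open>\<alpha> p [c\<^sub>1, \<dots>, c\<^sub>n]\<close> is the value at \<open>p\<close> of the degree \<open>n\<close> part of \<open>\<alpha>\<close> on the vectors
  $\partial_{c_1}, \ldots, \partial_{c_n}$. Sums and differences of forms are the pointwise ones of
  function spaces.
\<close>

type_synonym form = "jet \<Rightarrow> coord list \<Rightarrow> complex"

definition form_on :: "nat \<Rightarrow> form \<Rightarrow> bool" where
  "form_on k \<alpha> \<longleftrightarrow>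
     (\<forall>p cs i j. i < j \<and> j < length cs \<longrightarrow>
        \<alpha> p (cs[i := cs ! j, j := cs ! i]) = - \<alpha> p cs) \<and>
     (\<forall>p cs. (\<exists>c \<in> set cs. \<not> coord_on k c) \<longrightarrow> \<alpha> p cs = 0) \<and>
     (\<forall>cs. smooth_fun_on k (\<lambda>p. \<alpha> p cs))"

definition is_form :: "form \<Rightarrow> bool" where
  "is_form \<alpha> \<longleftrightarrow> (\<exists>k. form_on k \<alpha>)"

definition homogeneous :: "nat \<Rightarrow> form \<Rightarrow> bool" where
  "homogeneous n \<alpha> \<longleftrightarrow> (\<forall>p cs. length cs \<noteq> n \<longrightarrow> \<alpha> p cs = 0)"

definition fn_form :: "(jet \<Rightarrow> complex) \<Rightarrow> form" where
  "fn_form F p cs = (if cs = [] then F p else 0)"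

definition scale :: "(jet \<Rightarrow> complex) \<Rightarrow> form \<Rightarrow> form"  (infixr "\<cdot>\<^sub>F" 75) where
  "(F \<cdot>\<^sub>F \<alpha>) p cs = F p * \<alpha> p cs"

text \<open>
  The sum runs over all shuffles, a shuffle being determined by the set \<open>S\<close> of the positions of the
  arguments that go to the first factor; no factorials occur, so
  $(\alpha \wedge \beta)(v, w) = \alpha(v) \beta(w) - \alpha(w) \beta(v)$ for 1-forms.
\<close>

definition wedge :: "form \<Rightarrow> form \<Rightarrow> form"  (infixl "\<curlywedge>" 70) where
  "(\<alpha> \<curlywedge> \<beta>) p cs =
     (\<Sum>S \<in> Pow {..<length cs}.
        (- 1) ^ card {(i, j). i \<in> S \<and> j \<in> {..<length cs} - S \<and> j < i} *
        \<alpha> p (nths cs S) * \<beta> p (nths cs ({..<length cs} - S)))"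

text \<open>
  Exterior derivative: $d\alpha(\partial_{c_0}, \ldots, \partial_{c_n}) = \sum_i (-1)^i \partial_{c_i}
  (\alpha(\partial_{c_0}, \ldots, \widehat{\partial_{c_i}}, \ldots, \partial_{c_n}))$, because
  coordinate vector fields commute.
\<close>

definition ext_d :: "form \<Rightarrow> form" where
  "ext_d \<alpha> p cs =
     (\<Sum>i<length cs. (- 1) ^ i * partial (cs ! i) (\<lambda>q. \<alpha> q (take i cs @ drop (Suc i) cs)) p)"

definition conj_form :: "form \<Rightarrow> form" where
  "conj_form \<alpha> p cs = cnj (\<alpha> p (map conj_coord cs))"

definition real_form :: "form \<Rightarrow> bool" where
  "real_form \<alpha> \<longleftrightarrow> conj_form \<alpha> = \<alpha>"

definition Im_form :: "form \<Rightarrow> form" where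
  "Im_form \<alpha> = (\<lambda>_. 1 / (2 * \<i>)) \<cdot>\<^sub>F (\<alpha> - conj_form \<alpha>)"


section \<open>The equation $u_{z \bar z} = - f(u)$\<close>

declare sum.cong [fundef_cong]

fun T :: "(real \<Rightarrow> real) \<Rightarrow> nat \<Rightarrow> jet \<Rightarrow> complex" where
  "T f 0 = (\<lambda>p. of_real (f (u_of p)))"
| "T f (Suc i) = (\<lambda>p. \<Sum>j = 0..i. of_nat (i choose j) * uj_of (i - j) p * partial U (T f j) p)"

definition zeta :: form where
  "zeta = ext_d (fn_form z_of)"

text \<open>\<open>omega_Suc f i\<close> is $\omega_{i+1}$.\<close>

definition omega_Suc :: "(real \<Rightarrow> real) \<Rightarrow> nat \<Rightarrow> form" where
  "omega_Suc f i = ext_d (fn_form (uj_of i)) + T f i \<cdot>\<^sub>F conj_form zeta"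

fun eta :: "(real \<Rightarrow> real) \<Rightarrow> nat \<Rightarrow> form" where
  "eta f 0 = ext_d (fn_form (\<lambda>p. of_real (u_of p)))
     - uj_of 0 \<cdot>\<^sub>F zeta - (\<lambda>p. cnj (uj_of 0 p)) \<cdot>\<^sub>F conj_form zeta"
| "eta f (Suc i) = omega_Suc f i - uj_of (Suc i) \<cdot>\<^sub>F zeta"

definition psi :: "(real \<Rightarrow> real) \<Rightarrow> form" where
  "psi f = Im_form (zeta \<curlywedge> omega_Suc f 0)"

inductive_set diff_ideal :: "(real \<Rightarrow> real) \<Rightarrow> form set" for f where
  eta: "eta f i \<in> diff_ideal f"
| eta_bar: "i \<ge> 1 \<Longrightarrow> conj_form (eta f i) \<in> diff_ideal f"
| add: "\<alpha> \<in> diff_ideal f \<Longrightarrow> \<beta> \<in> diff_ideal f \<Longrightarrow> \<alpha> + \<beta> \<in> diff_ideal f"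
| wedge_left: "is_form \<gamma> \<Longrightarrow> \<alpha> \<in> diff_ideal f \<Longrightarrow> \<gamma> \<curlywedge> \<alpha> \<in> diff_ideal f"
| wedge_right: "is_form \<gamma> \<Longrightarrow> \<alpha> \<in> diff_ideal f \<Longrightarrow> \<alpha> \<curlywedge> \<gamma> \<in> diff_ideal f"
| ext_d: "\<alpha> \<in> diff_ideal f \<Longrightarrow> ext_d \<alpha> \<in> diff_ideal f"

text \<open>
  The vector fields $e_{-1}$ and $e_{\overline{-1}}$. For a function on some $M^{(k)}$ only finitely
  many terms of the two series are nonzero. The conjugate of a vector field $X$ is
  $\bar X F = \overline{X \bar F}$.
\<close>

definition e_minus1 :: "(real \<Rightarrow> real) \<Rightarrow> (jet \<Rightarrow> complex) \<Rightarrow> jet \<Rightarrow> complex" where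
  "e_minus1 f F p = partial Z F p + uj_of 0 p * partial U F p
     + (\<Sum>i. uj_of (Suc i) p * partial (Uj i) F p)
     - (\<Sum>i. cnj (T f i p) * partial (Ujbar i) F p)"

definition e_minus1_bar :: "(real \<Rightarrow> real) \<Rightarrow> (jet \<Rightarrow> complex) \<Rightarrow> jet \<Rightarrow> complex" where
  "e_minus1_bar f F p = cnj (e_minus1 f (\<lambda>q. cnj (F q)) p)"

definition has_weighted_degree :: "(jet \<Rightarrow> complex) \<Rightarrow> int \<Rightarrow> bool" where
  "has_weighted_degree P d \<longleftrightarrow>
     (\<forall>l z u w. norm l = 1 \<longrightarrow> P (inverse l * z, u, \<lambda>j. l ^ (j + 1) * w j) = l powi d * P (z, u, w))"

definition V :: "(real \<Rightarrow> real) \<Rightarrow> int \<Rightarrow> (jet \<Rightarrow> complex) set" where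
  "V f d = {P. smooth_fun P \<and> has_weighted_degree P d \<and>
     (\<forall>p. e_minus1_bar f (e_minus1 f P) p + of_real (deriv f (u_of p)) * P p = 0) \<and>
     (\<forall>p. partial U P p = 0) \<and>
     (\<forall>i j p. partial (Ujbar j) (partial (Uj i) P) p = 0)}"

definition conservation_laws :: "(real \<Rightarrow> real) \<Rightarrow> form set" where
  "conservation_laws f = {\<Phi>. is_form \<Phi> \<and> homogeneous 2 \<Phi> \<and> real_form \<Phi> \<and> ext_d \<Phi> = 0 \<and>
     \<Phi> \<in> diff_ideal f \<and>
     (\<exists>k \<rho> A B D.
        is_form \<rho> \<and> homogeneous 1 \<rho> \<and>
        smooth_fun A \<and> (\<forall>p. A p \<in> \<real>) \<and>
        (\<forall>i j. smooth_fun (B i j)) \<and> (\<forall>i j. smooth_fun (D i j)) \<and>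
        \<Phi> = eta f 0 \<curlywedge> \<rho> + A \<cdot>\<^sub>F psi f
          + (\<Sum>(i, j) \<in> {(i, j). 1 \<le> i \<and> i < j \<and> j \<le> k}.
               B i j \<cdot>\<^sub>F (eta f i \<curlywedge> eta f j)
               + (\<lambda>p. cnj (B i j p)) \<cdot>\<^sub>F (conj_form (eta f i) \<curlywedge> conj_form (eta f j)))
          + (\<Sum>(i, j) \<in> {(i, j). 1 \<le> i \<and> i \<le> j \<and> j \<le> k}.
               D i j \<cdot>\<^sub>F (eta f i \<curlywedge> conj_form (eta f j))
               + (\<lambda>p. cnj (D i j p)) \<cdot>\<^sub>F (conj_form (eta f i) \<curlywedge> eta f j)))}"

text \<open>$\mathcal{C}_{(k)} \subset \mathcal{C}$; its elements for \<open>k = 0\<close> are the classical conservation laws.\<close>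

definition conservation_laws_on :: "(real \<Rightarrow> real) \<Rightarrow> nat \<Rightarrow> form set" where
  "conservation_laws_on f k = {\<Phi> \<in> conservation_laws f. form_on k \<Phi>}"

end

theory Submission
  imports Defs
begin

text \<open>
  A solution $P$ of the linearized equation with $P_u = 0$ and $P_{u_i \bar u_j} = 0$ has holomorphic
  derivatives with respect to the $u_i$. If $u_k$ with $k \ge 1$ is the highest of these coordinates in
  $P$, the coefficients of $u_{k+1}$, $u_k$ and $u_{k-1}$ in the equation give first order equations for
  $P_{u_k}$, $P_{u_{k-1}}$ and $P_{u_{k-2}}$. Since $u$ occurs in them only through $f$ and its derivatives,
  they can be evaluated at arbitrary values of $u$; iterated brackets of the resulting vector fields span
  all $\partial_{u_i}$, and the independence of $f$, $f'$, $f''$ forces $P_{u_k} = 0$. What remains is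
  $P = (\alpha + \gamma z) u_0 + (\beta - \gamma \bar z) \bar u_0$, a sum of terms of weights $1$, $0$, $-1$.

  For a closed 2-form in normal form, contraction with $e_{-1}$ shows that its coefficient $A$ is such a
  solution and that all components along $\partial_{u_j}$ with $j \ge 1$ are determined by the $A_{u_i}$ with
  $i \ge 1$, hence vanish. Closedness then makes the remaining components independent of these $u_j$.
\<close>

section \<open>Calculus of smooth functions on the jet space\<close>

text \<open>Independence of f, f', f'' is used in three ways. The vectors (f'(v), f''(v)) span the
  plane, so two evaluations combine into fields X_a, X_b whose jets begin with (0, 1) and (1, 0);
  this starts the triangular family of brackets. The brackets express R_{u_0} and R_{u_1} through a
  possible obstruction q, and the equation before differentiation in u, in which f itself occurs,
  then yields (f'' - b_2 f - a_2 f') q = 0: a linear second order ODE wherever q is nonzero. Finally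
  f'' h = f' b with h, b free of u separates into h = b = 0.

  For 2-forms the engine is Cartan's formula L_D Phi = d(i_D Phi) with D = e_{-1}. The contact forms
  eta_i and their conjugates vanish on D, so i_D Phi is a combination of eta_0 and A eta_1 / (2i).
  Since the bracket of d/du_{j+1} with D is d/du_j, the formula is a recursion descending from
  indices so large that all components vanish. Contracting it once more, with the conjugate of D,
  gives the linearized equation for A.\<close>

lemma translate_translate: "translate c s (translate c t p) = translate c (s + t) p"
  by (cases c; cases p) (auto simp: algebra_simps)

lemma translate_commute: "translate c s (translate d t p) = translate d t (translate c s p)"
  by (cases c; cases d; cases p) (auto simp: algebra_simps fun_upd_twist)

lemma translate_0 [simp]: "translate c 0 p = p"
  by (cases c; cases p) auto

lemma translate_simps [simp]:
  "z_of (translate ReZ t p) = z_of p + of_real t"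
  "z_of (translate ImZ t p) = z_of p + \<i> * of_real t"
  "z_of (translate RealU t p) = z_of p"
  "z_of (translate (ReUj j) t p) = z_of p"
  "z_of (translate (ImUj j) t p) = z_of p"
  "u_of (translate ReZ t p) = u_of p"
  "u_of (translate ImZ t p) = u_of p"
  "u_of (translate RealU t p) = u_of p + t"
  "u_of (translate (ReUj j) t p) = u_of p"
  "u_of (translate (ImUj j) t p) = u_of p"
  "uj_of i (translate ReZ t p) = uj_of i p"
  "uj_of i (translate ImZ t p) = uj_of i p"
  "uj_of i (translate RealU t p) = uj_of i p"
  "uj_of i (translate (ReUj j) t p) = uj_of i p + (if i = j then of_real t else 0)"
  "uj_of i (translate (ImUj j) t p) = uj_of i p + (if i = j then \<i> * of_real t else 0)"
  by (cases p; simp add: z_of_def u_of_def uj_of_def)+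

lemma continuous_on_coords [continuous_intros]:
  assumes "continuous_on S g"
  shows "continuous_on S (\<lambda>x. z_of (g x))" "continuous_on S (\<lambda>x. u_of (g x))"
    "continuous_on S (\<lambda>x. uj_of j (g x))"
  unfolding z_of_def u_of_def uj_of_def
  by (intro continuous_intros assms continuous_on_product_then_coordinatewise[of S "\<lambda>x. snd (snd (g x))"])+

lemma translate_eq:
  "translate c t p =
    (z_of p + (case c of ReZ \<Rightarrow> of_real t | ImZ \<Rightarrow> \<i> * of_real t | _ \<Rightarrow> 0),
     u_of p + (case c of RealU \<Rightarrow> t | _ \<Rightarrow> 0),
     \<lambda>i. uj_of i p + (case c of ReUj j \<Rightarrow> if i = j then of_real t else 0
        | ImUj j \<Rightarrow> if i = j then \<i> * of_real t else 0 | _ \<Rightarrow> 0))"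
  by (cases c; cases p) (auto simp: z_of_def u_of_def uj_of_def)

lemma continuous_on_translate [continuous_intros]:
  assumes "continuous_on S h" "continuous_on S g"
  shows "continuous_on S (\<lambda>x. translate c (h x) (g x))"
  unfolding translate_eq
proof (intro continuous_on_Pair continuous_on_coordinatewise_then_product)
  show "continuous_on S (\<lambda>x. uj_of i (g x) + (case c of
      ReUj j \<Rightarrow> if i = j then of_real (h x) else 0
    | ImUj j \<Rightarrow> if i = j then \<i> * of_real (h x) else 0 | _ \<Rightarrow> 0))" for i
  proof (cases "c = ReUj i \<or> c = ImUj i")
    case True
    then show ?thesis by (auto intro!: continuous_intros assms)
  next
    case False
    then have "(case c of ReUj j \<Rightarrow> if i = j then of_real (h x) else 0
      | ImUj j \<Rightarrow> if i = j then \<i> * of_real (h x) else 0 | _ \<Rightarrow> 0) = (0 :: complex)" for x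
      by (auto split: real_coord.splits)
    then show ?thesis by (auto intro!: continuous_intros assms)
  qed
qed (cases c; auto intro!: continuous_intros assms)+

abbreviation partially_differentiable :: "(jet \<Rightarrow> complex) \<Rightarrow> bool" where
  "partially_differentiable F \<equiv> (\<forall>c p. (\<lambda>t. F (translate c t p)) differentiable (at 0))"

definition depends_upto :: "nat \<Rightarrow> (jet \<Rightarrow> complex) \<Rightarrow> bool" where
  "depends_upto k F \<longleftrightarrow> (\<forall>z u v w. (\<forall>j\<le>k. v j = w j) \<longrightarrow> F (z, u, v) = F (z, u, w))"

lemma has_real_partial:
  assumes "partially_differentiable F"
  shows "((\<lambda>t. F (translate c t p)) has_vector_derivative real_partial c F (translate c s p)) (at s)"
proof -
  have "((\<lambda>t. F (translate c t (translate c s p))) has_vector_derivative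
      real_partial c F (translate c s p)) (at 0)"
    unfolding real_partial_def using assms vector_derivative_works by blast
  then have "((\<lambda>t. F (translate c t (translate c s p))) \<circ> (\<lambda>t. t - s) has_vector_derivative
      1 *\<^sub>R real_partial c F (translate c s p)) (at s)"
    by (intro vector_diff_chain_at) (auto intro!: derivative_eq_intros)
  then show ?thesis by (simp add: o_def translate_translate)
qed

lemma has_real_partial_0:
  assumes "partially_differentiable F"
  shows "((\<lambda>t. F (translate c t p)) has_vector_derivative real_partial c F p) (at 0)"
  using has_real_partial[OF assms, of c p 0] by simp

lemma real_partial_eqI:
  "((\<lambda>t. F (translate c t p)) has_vector_derivative D) (at 0) \<Longrightarrow> real_partial c F p = D"
  unfolding real_partial_def by (rule vector_derivative_at)

lemma has_vector_derivative_differentiable: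
  "(f has_vector_derivative D) F \<Longrightarrow> f differentiable F"
  unfolding has_vector_derivative_def differentiable_def by blast

lemma depends_upto_real_partial:
  assumes "depends_upto k F" shows "depends_upto k (real_partial c F)"
proof -
  have "(\<lambda>t. F (translate c t (z, u, v))) = (\<lambda>t. F (translate c t (z, u, w)))"
    if "\<forall>j\<le>k. v j = w j" for z u v w
    using that assms[unfolded depends_upto_def] by (cases c) (auto intro!: ext)
  then show ?thesis unfolding depends_upto_def real_partial_def by (intro allI impI arg_cong[where f="\<lambda>h. vector_derivative h (at 0)"]) blast
qed

lemma smooth_fun_on_iff:
  "smooth_fun_on k F \<longleftrightarrow> depends_upto k F \<and>
    (\<forall>cs. continuous_on UNIV (foldr real_partial cs F) \<and>
      partially_differentiable (foldr real_partial cs F))"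
  unfolding smooth_fun_on_def depends_upto_def by blast

lemma smooth_fun_onD:
  assumes "smooth_fun_on k F"
  shows "depends_upto k F" "continuous_on UNIV F" "partially_differentiable F"
  using assms[unfolded smooth_fun_on_iff] by (auto dest: spec[of _ "[]"])

lemma smooth_fun_on_real_partial:
  assumes "smooth_fun_on k F" shows "smooth_fun_on k (real_partial c F)"
  unfolding smooth_fun_on_iff
proof (intro conjI allI)
  show "depends_upto k (real_partial c F)"
    using assms smooth_fun_on_iff depends_upto_real_partial by blast
  fix cs
  have "foldr real_partial cs (real_partial c F) = foldr real_partial (cs @ [c]) F" by simp
  then show "continuous_on UNIV (foldr real_partial cs (real_partial c F))"
    "(\<lambda>t. foldr real_partial cs (real_partial c F) (translate d t p)) differentiable (at 0)" for d p
    using assms unfolding smooth_fun_on_iff by metis+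
qed

text \<open>Iterated derivatives seldom have a usable closed form. It is enough that they never
  leave a set \<open>S\<close> of continuous, partially differentiable functions, so the closure
  proofs below only have to choose \<open>S\<close>.\<close>

lemma smooth_fun_on_coinduct:
  assumes "F \<in> S" "depends_upto k F"
    and "\<And>G. G \<in> S \<Longrightarrow> continuous_on UNIV G"
    and "\<And>G. G \<in> S \<Longrightarrow> partially_differentiable G"
    and "\<And>G c. G \<in> S \<Longrightarrow> real_partial c G \<in> S"
  shows "smooth_fun_on k F"
proof -
  have "foldr real_partial cs F \<in> S" for cs
    by (induction cs) (use assms in auto)
  then show ?thesis unfolding smooth_fun_on_iff using assms by blast
qed

lemma smooth_fun_on_mono: "smooth_fun_on k F \<Longrightarrow> k \<le> l \<Longrightarrow> smooth_fun_on l F"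
  unfolding smooth_fun_on_def by (meson le_trans)

section \<open>Smoothness of sums, products, conjugates and coordinate functions\<close>

lemma real_partial_add:
  assumes "partially_differentiable F" "partially_differentiable G"
  shows "real_partial c (\<lambda>p. F p + G p) = (\<lambda>p. real_partial c F p + real_partial c G p)"
    "partially_differentiable (\<lambda>p. F p + G p)"
proof -
  have *: "((\<lambda>t. F (translate c t p) + G (translate c t p)) has_vector_derivative
     real_partial c F p + real_partial c G p) (at 0)" for c p
    by (intro has_vector_derivative_add has_real_partial_0 assms)
  show "real_partial c (\<lambda>p. F p + G p) = (\<lambda>p. real_partial c F p + real_partial c G p)"
    by (intro ext real_partial_eqI *)
  show "partially_differentiable (\<lambda>p. F p + G p)"
    using * has_vector_derivative_differentiable by blast
qed

lemma real_partial_mult: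
  assumes "partially_differentiable F" "partially_differentiable G"
  shows "real_partial c (\<lambda>p. F p * G p) = (\<lambda>p. F p * real_partial c G p + real_partial c F p * G p)"
    "partially_differentiable (\<lambda>p. F p * G p)"
proof -
  have *: "((\<lambda>t. F (translate c t p) * G (translate c t p)) has_vector_derivative
     F p * real_partial c G p + real_partial c F p * G p) (at 0)" for c p
    using has_vector_derivative_mult[OF has_real_partial_0[OF assms(1), of c p] has_real_partial_0[OF assms(2), of c p]]
    by simp
  show "real_partial c (\<lambda>p. F p * G p) = (\<lambda>p. F p * real_partial c G p + real_partial c F p * G p)"
    by (intro ext real_partial_eqI *)
  show "partially_differentiable (\<lambda>p. F p * G p)"
    using * has_vector_derivative_differentiable by blast
qed

lemma real_partial_cnj:
  assumes "partially_differentiable F"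
  shows "real_partial c (\<lambda>p. cnj (F p)) = (\<lambda>p. cnj (real_partial c F p))"
    "partially_differentiable (\<lambda>p. cnj (F p))"
proof -
  have *: "((\<lambda>t. cnj (F (translate c t p))) has_vector_derivative cnj (real_partial c F p)) (at 0)" for c p
    by (intro has_vector_derivative_cnj has_real_partial_0 assms)
  show "real_partial c (\<lambda>p. cnj (F p)) = (\<lambda>p. cnj (real_partial c F p))"
    by (intro ext real_partial_eqI *)
  show "partially_differentiable (\<lambda>p. cnj (F p))"
    using * has_vector_derivative_differentiable by blast
qed

text \<open>Derivatives of a product are sums of products, so products alone are not closed under
  \<open>real_partial\<close>. This inductive closure is, and it serves as the set \<open>S\<close>
  of \<open>smooth_fun_on_coinduct\<close>.\<close>

inductive_set smooth_algebra :: "nat \<Rightarrow> (jet \<Rightarrow> complex) set" for k where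
  base: "smooth_fun_on k F \<Longrightarrow> F \<in> smooth_algebra k"
| add: "F \<in> smooth_algebra k \<Longrightarrow> G \<in> smooth_algebra k \<Longrightarrow> (\<lambda>p. F p + G p) \<in> smooth_algebra k"
| mult: "F \<in> smooth_algebra k \<Longrightarrow> G \<in> smooth_algebra k \<Longrightarrow> (\<lambda>p. F p * G p) \<in> smooth_algebra k"

lemma depends_upto_combine:
  assumes "depends_upto k F" "depends_upto k G" shows "depends_upto k (\<lambda>p. h (F p) (G p))"
  unfolding depends_upto_def
proof (intro allI impI)
  fix z u and v w :: "nat \<Rightarrow> complex"
  assume "\<forall>j\<le>k. v j = w j"
  then have "F (z, u, v) = F (z, u, w)" "G (z, u, v) = G (z, u, w)"
    using assms unfolding depends_upto_def by blast+
  then show "h (F (z, u, v)) (G (z, u, v)) = h (F (z, u, w)) (G (z, u, w))" by simp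
qed

lemma smooth_algebra_props: "F \<in> smooth_algebra k \<Longrightarrow> continuous_on UNIV F \<and> partially_differentiable F \<and> depends_upto k F \<and>
      (\<forall>c. real_partial c F \<in> smooth_algebra k)"
proof (induction rule: smooth_algebra.induct)
  case (base F)
  show ?case
    by (intro conjI smooth_fun_onD[OF base]) (rule allI, rule smooth_algebra.base, rule smooth_fun_on_real_partial, rule base)
next
  case (add F G)
  then have F: "continuous_on UNIV F" "partially_differentiable F" "depends_upto k F" "\<And>c. real_partial c F \<in> smooth_algebra k"
   and G: "continuous_on UNIV G" "partially_differentiable G" "depends_upto k G" "\<And>c. real_partial c G \<in> smooth_algebra k"
    by blast+
  have "real_partial c (\<lambda>p. F p + G p) \<in> smooth_algebra k" for c
    unfolding real_partial_add(1)[OF F(2) G(2)] by (rule smooth_algebra.add[OF F(4) G(4)])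
  then show ?case
    using real_partial_add(2)[OF F(2) G(2)] depends_upto_combine[OF F(3) G(3), of "(+)"] continuous_on_add[OF F(1) G(1)] by blast
next
  case (mult F G)
  then have F: "continuous_on UNIV F" "partially_differentiable F" "depends_upto k F" "\<And>c. real_partial c F \<in> smooth_algebra k"
   and G: "continuous_on UNIV G" "partially_differentiable G" "depends_upto k G" "\<And>c. real_partial c G \<in> smooth_algebra k"
    by blast+
  have "real_partial c (\<lambda>p. F p * G p) \<in> smooth_algebra k" for c
    unfolding real_partial_mult(1)[OF F(2) G(2)]
    by (rule smooth_algebra.add[OF smooth_algebra.mult[OF mult(1) G(4)] smooth_algebra.mult[OF F(4) mult(2)]])
  then show ?case
    using real_partial_mult(2)[OF F(2) G(2)] depends_upto_combine[OF F(3) G(3), of "(*)"] continuous_on_mult[OF F(1) G(1)] by blast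
qed

lemma smooth_algebra_smooth:
  assumes "F \<in> smooth_algebra k" shows "smooth_fun_on k F"
  by (rule smooth_fun_on_coinduct[OF assms]) (use smooth_algebra_props assms in blast)+

lemma smooth_fun_on_add: "smooth_fun_on k F \<Longrightarrow> smooth_fun_on k G \<Longrightarrow> smooth_fun_on k (\<lambda>p. F p + G p)"
  by (rule smooth_algebra_smooth, rule smooth_algebra.add; rule smooth_algebra.base)
lemma smooth_fun_on_mult: "smooth_fun_on k F \<Longrightarrow> smooth_fun_on k G \<Longrightarrow> smooth_fun_on k (\<lambda>p. F p * G p)"
  by (rule smooth_algebra_smooth, rule smooth_algebra.mult; rule smooth_algebra.base)

lemma smooth_fun_on_cnj:
  assumes "smooth_fun_on k F" shows "smooth_fun_on k (\<lambda>p. cnj (F p))"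
proof (rule smooth_fun_on_coinduct)
  let ?S = "(\<lambda>F p. cnj (F p)) ` Collect (smooth_fun_on k)"
  show "(\<lambda>p. cnj (F p)) \<in> ?S" using assms by blast
  show "depends_upto k (\<lambda>p. cnj (F p))"
    using smooth_fun_onD(1)[OF assms] by (simp add: depends_upto_def)
  fix G assume "G \<in> ?S"
  then obtain H where H: "smooth_fun_on k H" "G = (\<lambda>p. cnj (H p))" by blast
  note D = smooth_fun_onD[OF H(1)]
  show "continuous_on UNIV G" using D by (auto simp: H intro!: continuous_intros)
  show "partially_differentiable G" using real_partial_cnj(2)[OF D(3)] by (simp add: H)
  show "real_partial c G \<in> ?S" for c
    unfolding H(2) real_partial_cnj(1)[OF D(3)]
    by (rule image_eqI[OF refl]) (simp add: smooth_fun_on_real_partial[OF H(1)])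
qed

lemma real_partial_const [simp]: "real_partial c (\<lambda>p. a) = (\<lambda>p. 0)"
  by (rule ext, rule real_partial_eqI, rule has_vector_derivative_const)

lemma smooth_fun_on_const: "smooth_fun_on k (\<lambda>p. a)"
proof (rule smooth_fun_on_coinduct)
  let ?S = "{G :: jet \<Rightarrow> complex. \<exists>a. G = (\<lambda>p. a)}"
  show "(\<lambda>p. a) \<in> ?S" by blast
  show "depends_upto k (\<lambda>p. a)" by (simp add: depends_upto_def)
  show "continuous_on UNIV G" if "G \<in> ?S" for G using that by auto
  show "partially_differentiable G" if "G \<in> ?S" for G using that by auto
  show "real_partial c G \<in> ?S" if "G \<in> ?S" for G c using that by auto
qed

lemma smooth_fun_on_diff:
  assumes "smooth_fun_on k F" "smooth_fun_on k G" shows "smooth_fun_on k (\<lambda>p. F p - G p)"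
  using smooth_fun_on_add[OF assms(1) smooth_fun_on_mult[OF smooth_fun_on_const[of k "-1"] assms(2)]]
  by simp

lemma smooth_fun_on_affine:
  assumes "depends_upto k F" "continuous_on UNIV F"
    and D: "\<And>c p. ((\<lambda>t. F (translate c t p)) has_vector_derivative D c) (at 0)"
  shows "smooth_fun_on k F"
proof (rule smooth_fun_on_coinduct)
  let ?S = "insert F {G :: jet \<Rightarrow> complex. \<exists>a. G = (\<lambda>p. a)}"
  show "F \<in> ?S" by simp
  have "real_partial c F = (\<lambda>p. D c)" for c by (rule ext, rule real_partial_eqI, rule D)
  then show "real_partial c G \<in> ?S" if "G \<in> ?S" for c G using that by auto
  show "continuous_on UNIV G" if "G \<in> ?S" for G using that assms(2) by auto
  have "partially_differentiable F" using has_vector_derivative_differentiable[OF D] by blast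
  then show "partially_differentiable G" if "G \<in> ?S" for G
    using that by auto
qed (use assms in auto)

lemma has_vector_derivative_of_real_linear: "((\<lambda>t. a + b * complex_of_real t) has_vector_derivative b) (at 0)"
  unfolding has_vector_derivative_def
  by (auto intro!: derivative_eq_intros simp: scaleR_conv_of_real mult.commute)

lemma has_vector_derivative_coords:
  "((\<lambda>t. uj_of j (translate c t p)) has_vector_derivative
     (case c of ReUj i \<Rightarrow> if j = i then 1 else 0 | ImUj i \<Rightarrow> if j = i then \<i> else 0 | _ \<Rightarrow> 0)) (at 0)"
  "((\<lambda>t. z_of (translate c t p)) has_vector_derivative
     (case c of ReZ \<Rightarrow> 1 | ImZ \<Rightarrow> \<i> | _ \<Rightarrow> 0)) (at 0)"
proof -
  have "uj_of j (translate c t p) = uj_of j p + (case c of ReUj i \<Rightarrow> if j = i then 1 else 0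
      | ImUj i \<Rightarrow> if j = i then \<i> else 0 | _ \<Rightarrow> 0) * complex_of_real t"
    "z_of (translate c t p) = z_of p + (case c of ReZ \<Rightarrow> 1 | ImZ \<Rightarrow> \<i> | _ \<Rightarrow> 0) * complex_of_real t" for t
    by (cases c; simp)+
  then show "((\<lambda>t. uj_of j (translate c t p)) has_vector_derivative
     (case c of ReUj i \<Rightarrow> if j = i then 1 else 0 | ImUj i \<Rightarrow> if j = i then \<i> else 0 | _ \<Rightarrow> 0)) (at 0)"
    "((\<lambda>t. z_of (translate c t p)) has_vector_derivative
     (case c of ReZ \<Rightarrow> 1 | ImZ \<Rightarrow> \<i> | _ \<Rightarrow> 0)) (at 0)"
    by (simp_all only: has_vector_derivative_of_real_linear)
qed

lemma smooth_fun_on_uj_of: "smooth_fun_on j (uj_of j)"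
proof (rule smooth_fun_on_affine[OF _ _ has_vector_derivative_coords(1)])
  show "depends_upto j (uj_of j)" by (simp add: depends_upto_def uj_of_def)
  show "continuous_on UNIV (uj_of j)" using continuous_on_coords(3)[OF continuous_on_id] by simp
qed

lemma smooth_fun_on_z_of: "smooth_fun_on 0 z_of"
proof (rule smooth_fun_on_affine[OF _ _ has_vector_derivative_coords(2)])
  show "depends_upto 0 z_of" by (simp add: depends_upto_def z_of_def)
  show "continuous_on UNIV z_of" using continuous_on_coords(1)[OF continuous_on_id] by simp
qed

lemma has_vector_derivative_of_real_comp:
  fixes g :: "real \<Rightarrow> real"
  assumes "g differentiable (at (u_of p))"
  shows "((\<lambda>t. complex_of_real (g (u_of (translate c t p)))) has_vector_derivative
     (if c = RealU then of_real (deriv g (u_of p)) else 0)) (at 0)"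
proof (cases "c = RealU")
  case True
  have "(g has_field_derivative deriv g (u_of p)) (at (0 + u_of p))"
    using assms DERIV_deriv_iff_real_differentiable by simp
  then have "((\<lambda>t. g (t + u_of p)) has_field_derivative deriv g (u_of p)) (at 0)"
    by (simp only: DERIV_shift)
  then have "((\<lambda>t. complex_of_real (g (t + u_of p))) has_vector_derivative of_real (deriv g (u_of p))) (at 0)"
    by (intro has_vector_derivative_of_real) (simp add: has_real_derivative_iff_has_vector_derivative)
  then show ?thesis using True by (simp add: add.commute)
next
  case False
  then have "u_of (translate c t p) = u_of p" for t by (cases c) auto
  then show ?thesis using False by simp
qed

lemma smooth_fun_on_comp_u:
  fixes f :: "real \<Rightarrow> real"
  assumes f: "\<And>n x. ((deriv ^^ n) f) differentiable (at x)"
  shows "smooth_fun_on 0 (\<lambda>p. of_real (f (u_of p)))"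
proof (rule smooth_fun_on_coinduct)
  define F where "F n = (\<lambda>p. complex_of_real ((deriv ^^ n) f (u_of p)))" for n
  let ?S = "insert (\<lambda>p. 0) (range F)"
  have "(\<lambda>p. complex_of_real (f (u_of p))) = F 0" by (simp add: F_def)
  then show "(\<lambda>p. complex_of_real (f (u_of p))) \<in> ?S" by simp
  show "depends_upto 0 (\<lambda>p. of_real (f (u_of p)))" by (simp add: depends_upto_def u_of_def)
  have C: "continuous_on UNIV ((deriv ^^ n) f)" for n
    using f by (simp add: continuous_on_eq_continuous_within differentiable_imp_continuous_within)
  have "continuous_on UNIV (F n)" for n
    unfolding F_def
    by (intro continuous_on_of_real continuous_on_compose2[OF C] continuous_on_coords continuous_on_id) simp
  then show "continuous_on UNIV G" if "G \<in> ?S" for G using that by auto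
  have D: "((\<lambda>t. F n (translate c t p)) has_vector_derivative
      (if c = RealU then F (Suc n) p else 0)) (at 0)" for n c p
    using has_vector_derivative_of_real_comp[OF f[of n "u_of p"], of c]
    by (cases "c = RealU") (simp_all add: F_def)
  then have "partially_differentiable (F n)" for n
    by (intro allI has_vector_derivative_differentiable)
  then show "partially_differentiable G" if "G \<in> ?S" for G using that by auto
  have "real_partial c (F n) = (if c = RealU then F (Suc n) else (\<lambda>p. 0))" for c n
    by (rule ext, subst real_partial_eqI[OF D]) simp
  then have "real_partial c (F n) \<in> ?S" for c n by (cases "c = RealU") simp_all
  then show "real_partial c G \<in> ?S" if "G \<in> ?S" for G c
    using that by auto
qed

text \<open>With \<open>q\<close> the two-parameter translation, F(q s b) - F(q s (-1)) is the
  integral over [-1, b] of the derivative \<open>G\<close> along \<open>d\<close>. Differentiating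
  in s under the integral sign and then in b at 0 produces the two mixed derivatives; continuity of
  \<open>H\<close> justifies both steps.\<close>

lemma real_partial_commute:
  assumes F: "smooth_fun_on k F"
  shows "real_partial c (real_partial d F) = real_partial d (real_partial c F)"
proof
  fix p
  define q where "q s t = translate c s (translate d t p)" for s t
  have q: "q s t = translate d t (translate c s p)" for s t
    unfolding q_def by (rule translate_commute)
  define G H where "G = real_partial d F" and "H = real_partial c G"
  have sG: "smooth_fun_on k G" unfolding G_def by (rule smooth_fun_on_real_partial[OF F])
  have sH: "smooth_fun_on k H" unfolding H_def by (rule smooth_fun_on_real_partial[OF sG])
  have dt: "((\<lambda>t. F (q s t)) has_vector_derivative G (q s t)) (at t)" for s t
    unfolding q G_def by (rule has_real_partial[OF smooth_fun_onD(3)[OF F]])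
  have ds: "((\<lambda>s. G (q s t)) has_vector_derivative H (q s t)) (at s)" for s t
    unfolding q_def H_def by (rule has_real_partial[OF smooth_fun_onD(3)[OF sG]])
  have dsF: "((\<lambda>s. F (q s t)) has_vector_derivative real_partial c F (q s t)) (at s)" for s t
    unfolding q_def by (rule has_real_partial[OF smooth_fun_onD(3)[OF F]])
  have cont: "continuous_on S (\<lambda>x. K (q (a x) (b x)))"
    if "smooth_fun_on k K" "continuous_on S a" "continuous_on S b" for K S and a b :: "'z::topological_space \<Rightarrow> real"
    unfolding q_def
    by (rule continuous_on_compose2[OF smooth_fun_onD(2)[OF that(1)]])
       (auto intro!: continuous_on_translate continuous_on_const that(2,3))
  \<comment> \<open>Integration starts at -1 so that b = 0 is interior to {-1..1}, where a
    derivative within the interval is a genuine one.\<close>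
  have int: "((\<lambda>t. G (q s t)) has_integral (F (q s b) - F (q s (-1)))) {-1..b}" if "b \<ge> -1" for s b
    by (rule fundamental_theorem_of_calculus[OF that]) (rule has_vector_derivative_at_within[OF dt])
  have L: "((\<lambda>s. integral (cbox (-1) b) (\<lambda>t. G (q s t))) has_vector_derivative
      integral (cbox (-1) b) (\<lambda>t. H (q 0 t))) (at 0 within UNIV)" for b :: real
  proof (rule leibniz_rule_vector_derivative)
    show "((\<lambda>s. G (q s t)) has_vector_derivative H (q s t)) (at s within UNIV)" for s t
      using ds by simp
    show "(\<lambda>t. G (q s t)) integrable_on cbox (- 1) b" for s
      by (rule integrable_continuous, rule cont[OF sG]) (auto intro: continuous_intros)
    show "continuous_on (UNIV \<times> cbox (- 1) b) (\<lambda>(x, t). H (q x t))"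
      unfolding case_prod_beta by (rule cont[OF sH]) (auto intro: continuous_intros)
  qed auto
  have I: "integral (cbox (-1) b) (\<lambda>t. G (q s t)) = F (q s b) - F (q s (-1))" if "b \<ge> -1" for s b
    using int[OF that] by (simp add: integral_unique)
  have 1: "((\<lambda>s. F (q s b) - F (q s (-1))) has_vector_derivative
      integral {-1..b} (\<lambda>t. H (q 0 t))) (at 0)" if "b \<ge> -1" for b
    using L[of b] unfolding I[OF that] by simp
  have D: "((\<lambda>s. F (q s b) - F (q s (-1))) has_vector_derivative
      real_partial c F (q 0 b) - real_partial c F (q 0 (-1))) (at 0)" for b
    by (intro has_vector_derivative_diff dsF)
  have eq: "real_partial c F (q 0 b) = integral {-1..b} (\<lambda>t. H (q 0 t)) + real_partial c F (q 0 (-1))"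
    if "b \<ge> -1" for b
    using vector_derivative_unique_at[OF 1[OF that] D] by simp
  have "((\<lambda>b. integral {-1..b} (\<lambda>t. H (q 0 t))) has_vector_derivative H (q 0 0)) (at 0 within {-1..1})"
    by (rule integral_has_vector_derivative, rule cont[OF sH]) (auto intro: continuous_intros)
  then have "((\<lambda>b. integral {-1..b} (\<lambda>t. H (q 0 t)) + real_partial c F (q 0 (-1)))
      has_vector_derivative H (q 0 0)) (at 0 within {-1..1})"
    by (simp add: has_vector_derivative_add_const)
  then have "((\<lambda>b. real_partial c F (q 0 b)) has_vector_derivative H (q 0 0)) (at 0 within {-1..1})"
    by (rule has_vector_derivative_transform[rotated 2]) (simp, rule eq, simp)
  then have "((\<lambda>b. real_partial c F (q 0 b)) has_vector_derivative H (q 0 0)) (at 0)"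
    by (simp add: at_within_interior[of 0 "{-1..1::real}"])
  then show "real_partial c (real_partial d F) p = real_partial d (real_partial c F) p"
    using real_partial_eqI[of "real_partial c F" d p] by (simp add: q_def G_def H_def)
qed


text \<open>Spares the case split over coordinates when the sum rule, the product rule and the
  symmetry of second derivatives pass from real to complex partials.\<close>

lemma partial_eq_real_partials:
  "\<exists>a b r s. \<forall>F. partial c F = (\<lambda>p. a * real_partial r F p + b * real_partial s F p)"
proof (cases c)
  case Z
  then show ?thesis by (intro exI[of _ "1/2"] exI[of _ "-\<i>/2"] exI[of _ ReZ] exI[of _ ImZ]) (auto simp: field_simps)
next
  case Zbar
  then show ?thesis by (intro exI[of _ "1/2"] exI[of _ "\<i>/2"] exI[of _ ReZ] exI[of _ ImZ]) (auto simp: field_simps)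
next
  case U
  then show ?thesis by (intro exI[of _ 1] exI[of _ 0] exI[of _ RealU]) auto
next
  case (Uj j)
  then show ?thesis by (intro exI[of _ "1/2"] exI[of _ "-\<i>/2"] exI[of _ "ReUj j"] exI[of _ "ImUj j"]) (auto simp: field_simps)
next
  case (Ujbar j)
  then show ?thesis by (intro exI[of _ "1/2"] exI[of _ "\<i>/2"] exI[of _ "ReUj j"] exI[of _ "ImUj j"]) (auto simp: field_simps)
qed

lemma smooth_fun_on_partial:
  assumes "smooth_fun_on k F" shows "smooth_fun_on k (partial c F)"
proof -
  obtain a b r s where *: "\<And>F. partial c F = (\<lambda>p. a * real_partial r F p + b * real_partial s F p)"
    using partial_eq_real_partials by metis
  show ?thesis unfolding *
    by (intro smooth_fun_on_add smooth_fun_on_mult smooth_fun_on_const smooth_fun_on_real_partial assms)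
qed

lemma smooth_fun_obtain2:
  assumes "smooth_fun F" "smooth_fun G"
  obtains k where "smooth_fun_on k F" "smooth_fun_on k G"
  using assms unfolding smooth_fun_def by (meson nle_le smooth_fun_on_mono)

lemma smooth_fun_partial: "smooth_fun F \<Longrightarrow> smooth_fun (partial c F)"
  unfolding smooth_fun_def using smooth_fun_on_partial by blast

lemma smooth_fun_partially_differentiable: "smooth_fun F \<Longrightarrow> partially_differentiable F"
  using smooth_fun_onD(3) unfolding smooth_fun_def by blast

lemma partial_add:
  assumes "smooth_fun F" "smooth_fun G"
  shows "partial c (\<lambda>p. F p + G p) p = partial c F p + partial c G p"
proof -
  obtain a b r s where *: "\<And>F. partial c F = (\<lambda>p. a * real_partial r F p + b * real_partial s F p)"
    using partial_eq_real_partials by metis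
  show ?thesis
    unfolding * real_partial_add(1)[OF assms[THEN smooth_fun_partially_differentiable]]
    by (simp add: algebra_simps)
qed

lemma partial_mult:
  assumes "smooth_fun F" "smooth_fun G"
  shows "partial c (\<lambda>p. F p * G p) p = partial c F p * G p + F p * partial c G p"
proof -
  obtain a b r s where *: "\<And>F. partial c F = (\<lambda>p. a * real_partial r F p + b * real_partial s F p)"
    using partial_eq_real_partials by metis
  show ?thesis
    unfolding * real_partial_mult(1)[OF assms[THEN smooth_fun_partially_differentiable]]
    by (simp add: algebra_simps)
qed

lemma partial_const: "partial c (\<lambda>p. a) p = 0"
  by (cases c) auto

lemma partial_cnj:
  assumes "smooth_fun F"
  shows "partial c (\<lambda>p. cnj (F p)) p = cnj (partial (conj_coord c) F p)"
  by (cases c) (simp_all add: real_partial_cnj(1)[OF smooth_fun_partially_differentiable[OF assms]])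

lemma real_partial_linear:
  assumes "smooth_fun_on k F" "smooth_fun_on k G"
  shows "real_partial c (\<lambda>p. a * F p + b * G p) = (\<lambda>p. a * real_partial c F p + b * real_partial c G p)"
proof -
  note C = smooth_fun_on_const[THEN smooth_fun_onD(3)] and D = assms[THEN smooth_fun_onD(3)]
  show ?thesis
    by (simp add: real_partial_add[OF real_partial_mult(2)[OF C D(1)] real_partial_mult(2)[OF C D(2)]]
        real_partial_mult[OF C D(1)] real_partial_mult[OF C D(2)])
qed

lemma partial_commute:
  assumes "smooth_fun F" shows "partial c (partial d F) = partial d (partial c F)"
proof -
  obtain k where k: "smooth_fun_on k F" using assms unfolding smooth_fun_def by blast
  note R = smooth_fun_on_real_partial[OF k]
  obtain a b r s where c: "\<And>F. partial c F = (\<lambda>p. a * real_partial r F p + b * real_partial s F p)"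
    using partial_eq_real_partials by metis
  obtain a' b' r' s' where d: "\<And>F. partial d F = (\<lambda>p. a' * real_partial r' F p + b' * real_partial s' F p)"
    using partial_eq_real_partials by metis
  have "real_partial x (real_partial y F) p = real_partial y (real_partial x F) p" for x y p
    using real_partial_commute[OF k] by metis
  note comm = this[of r r'] this[of r s'] this[of s r'] this[of s s']
  show ?thesis
    unfolding c d real_partial_linear[OF R R] comm
    by (simp add: algebra_simps)
qed

lemma partial_eq_0:
  assumes "depends_upto k F" "k < j" shows "partial (Uj j) F p = 0" "partial (Ujbar j) F p = 0"
proof -
  have "real_partial c F p = 0" if "c = ReUj j \<or> c = ImUj j" for c
  proof (rule real_partial_eqI)
    have "F (translate c t p) = F p" for t
      using that assms unfolding depends_upto_def by (cases p) auto
    then show "((\<lambda>t. F (translate c t p)) has_vector_derivative 0) (at 0)" by simp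
  qed
  then show "partial (Uj j) F p = 0" "partial (Ujbar j) F p = 0" by auto
qed

section \<open>Functions with vanishing partial derivatives\<close>

lemma real_partial_0_constant:
  assumes "smooth_fun F" "\<And>p. real_partial c F p = 0"
  shows "F (translate c t p) = F p"
proof -
  have "((\<lambda>t. F (translate c t p)) has_vector_derivative 0) (at s)" for s
    using has_real_partial[OF smooth_fun_partially_differentiable[OF assms(1)]] assms(2) by metis
  then obtain C where "\<And>t. F (translate c t p) = C"
    using has_vector_derivative_zero_constant[of UNIV "\<lambda>t. F (translate c t p)"] by auto
  then show ?thesis by (metis translate_0)
qed

lemma partial_U_0_constant:
  assumes "smooth_fun F" "\<And>p. partial U F p = 0"
  shows "F (z, u, w) = F (z, v, w)"
  using real_partial_0_constant[OF assms(1), of RealU "v - u" "(z, u, w)"] assms(2) by simp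

lemma partial_Uj_0_constant:
  assumes "smooth_fun F" "\<And>p. partial (Uj j) F p = 0" "\<And>p. partial (Ujbar j) F p = 0"
  shows "F (z, u, w(j := a)) = F (z, u, w)"
proof -
  have R: "real_partial (ReUj j) F p = partial (Uj j) F p + partial (Ujbar j) F p"
    "real_partial (ImUj j) F p = \<i> * (partial (Uj j) F p - partial (Ujbar j) F p)" for p
    by (auto simp: field_simps)
  have 0: "real_partial (ReUj j) F p = 0" "real_partial (ImUj j) F p = 0" for p
    unfolding R assms(2,3) by simp_all
  define d where "d = a - w j"
  have "w j + of_real (Re d) + \<i> * of_real (Im d) = a"
    by (auto simp: d_def complex_eq_iff)
  then have "translate (ImUj j) (Im d) (translate (ReUj j) (Re d) (z, u, w)) = (z, u, w(j := a))"
    by auto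
  then show ?thesis
    using real_partial_0_constant[OF assms(1) 0(1)] real_partial_0_constant[OF assms(1) 0(2)] by metis
qed

lemma partial_Z_0_constant:
  assumes "smooth_fun F" "\<And>p. partial Z F p = 0" "\<And>p. partial Zbar F p = 0"
  shows "F (z, u, w) = F (z', u, w)"
proof -
  have R: "real_partial ReZ F p = partial Z F p + partial Zbar F p"
    "real_partial ImZ F p = \<i> * (partial Z F p - partial Zbar F p)" for p
    by (auto simp: field_simps)
  have 0: "real_partial ReZ F p = 0" "real_partial ImZ F p = 0" for p
    unfolding R assms(2,3) by simp_all
  define d where "d = z - z'"
  have "z' + of_real (Re d) + \<i> * of_real (Im d) = z"
    by (auto simp: d_def complex_eq_iff)
  then have "translate ImZ (Im d) (translate ReZ (Re d) (z', u, w)) = (z, u, w)"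
    by auto
  then show ?thesis
    using real_partial_0_constant[OF assms(1) 0(1)] real_partial_0_constant[OF assms(1) 0(2)] by metis
qed

section \<open>The ring of smooth functions and its derivations\<close>

text \<open>As elements of a type, smooth functions form a commutative ring with derivations: the
  computations below become ring identities without smoothness side conditions.\<close>

typedef sfun = "{F. smooth_fun F}" morphisms fn Sfun
  using smooth_fun_on_const[of 0 0] by (auto simp: smooth_fun_def)

setup_lifting type_definition_sfun

lemma smooth_fun_fn [simp]: "smooth_fun (fn F)"
  using fn by simp

lemma smooth_fun_intros:
  "smooth_fun F \<Longrightarrow> smooth_fun G \<Longrightarrow> smooth_fun (\<lambda>p. F p + G p)"
  "smooth_fun F \<Longrightarrow> smooth_fun G \<Longrightarrow> smooth_fun (\<lambda>p. F p - G p)"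
  "smooth_fun F \<Longrightarrow> smooth_fun G \<Longrightarrow> smooth_fun (\<lambda>p. F p * G p)"
  "smooth_fun F \<Longrightarrow> smooth_fun (\<lambda>p. cnj (F p))"
  "smooth_fun (\<lambda>p. a)"
  using smooth_fun_on_add smooth_fun_on_diff smooth_fun_on_mult smooth_fun_on_cnj smooth_fun_on_const
  by (meson smooth_fun_def smooth_fun_obtain2)+

instantiation sfun :: comm_ring_1
begin

lift_definition zero_sfun :: sfun is "\<lambda>p. 0" by (rule smooth_fun_intros)
lift_definition one_sfun :: sfun is "\<lambda>p. 1" by (rule smooth_fun_intros)
lift_definition plus_sfun :: "sfun \<Rightarrow> sfun \<Rightarrow> sfun" is "\<lambda>F G p. F p + G p" by (rule smooth_fun_intros)
lift_definition minus_sfun :: "sfun \<Rightarrow> sfun \<Rightarrow> sfun" is "\<lambda>F G p. F p - G p" by (rule smooth_fun_intros)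
lift_definition times_sfun :: "sfun \<Rightarrow> sfun \<Rightarrow> sfun" is "\<lambda>F G p. F p * G p" by (rule smooth_fun_intros)
lift_definition uminus_sfun :: "sfun \<Rightarrow> sfun" is "\<lambda>F p. - F p"
  using smooth_fun_intros(2)[OF smooth_fun_intros(5)[of 0]] by simp

instance
  by standard (transfer; simp add: algebra_simps fun_eq_iff)+

end

lift_definition const :: "complex \<Rightarrow> sfun" is "\<lambda>a p. a" by (rule smooth_fun_intros)
lift_definition cj :: "sfun \<Rightarrow> sfun" is "\<lambda>F p. cnj (F p)" by (rule smooth_fun_intros)
lift_definition pd :: "coord \<Rightarrow> sfun \<Rightarrow> sfun" is partial by (rule smooth_fun_partial)
lift_definition uj :: "nat \<Rightarrow> sfun" is uj_of using smooth_fun_on_uj_of smooth_fun_def by blast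
lift_definition zc :: sfun is z_of using smooth_fun_on_z_of smooth_fun_def by blast

lemma fn_simps [simp]:
  "fn 0 p = 0" "fn 1 p = 1" "fn (F + G) p = fn F p + fn G p" "fn (F - G) p = fn F p - fn G p"
  "fn (- F) p = - fn F p" "fn (F * G) p = fn F p * fn G p" "fn (const a) p = a"
  "fn (cj F) p = cnj (fn F p)" "fn (pd c F) p = partial c (fn F) p" "fn (uj j) p = uj_of j p"
  "fn zc p = z_of p"
  by (transfer; simp)+

lemma fn_sum [simp]: "fn (sum F A) p = (\<Sum>x\<in>A. fn (F x) p)"
  by (induction A rule: infinite_finite_induct) simp_all

lemma fn_of_nat [simp]: "fn (of_nat n) p = of_nat n"
  by (induction n) simp_all

lemma sfun_eq_iff: "F = G \<longleftrightarrow> (\<forall>p. fn F p = fn G p)"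
  by transfer (simp add: fun_eq_iff)

lemma sfun_eqI: "(\<And>p. fn F p = fn G p) \<Longrightarrow> F = G"
  by (simp add: sfun_eq_iff)

lemma pd_add [simp]: "pd c (F + G) = pd c F + pd c G"
  by transfer (simp add: partial_add fun_eq_iff)

lemma pd_mult [simp]: "pd c (F * G) = pd c F * G + F * pd c G"
  by transfer (simp add: partial_mult fun_eq_iff)

lemma pd_const [simp]: "pd c (const a) = 0" "pd c 0 = 0" "pd c 1 = 0"
  by (transfer; simp add: partial_const fun_eq_iff)+

lemma pd_uminus [simp]: "pd c (- F) = - pd c F"
  using pd_add[of c F "-F"] by (simp add: add_eq_0_iff)

lemma pd_diff [simp]: "pd c (F - G) = pd c F - pd c G"
  using pd_add[of c F "- G"] by simp

lemma pd_sum [simp]: "pd c (sum F A) = (\<Sum>x\<in>A. pd c (F x))"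
  by (induction A rule: infinite_finite_induct) simp_all

lemma pd_of_nat [simp]: "pd c (of_nat n) = 0"
  by (induction n) simp_all

lemma pd_commute: "pd c (pd d F) = pd d (pd c F)"
  by transfer (rule partial_commute)

lemma pd_cj: "pd c (cj F) = cj (pd (conj_coord c) F)"
  by transfer (simp add: partial_cnj fun_eq_iff)

lemma cj_simps [simp]: "cj (F + G) = cj F + cj G" "cj (F - G) = cj F - cj G" "cj (- F) = - cj F"
  "cj (F * G) = cj F * cj G" "cj 0 = 0" "cj 1 = 1" "cj (cj F) = F" "cj (const a) = const (cnj a)"
  by (transfer; simp)+

lemma cj_sum: "cj (sum F A) = (\<Sum>x\<in>A. cj (F x))"
  by (induction A rule: infinite_finite_induct) simp_all

lemma cj_eq_0_iff [simp]: "cj F = 0 \<longleftrightarrow> F = 0"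
  by (metis cj_simps(5,7))

lemma pd_uj [simp]: "pd c (uj j) = (if c = Uj j then 1 else 0)"
proof (rule sfun_eqI)
  have *: "fn (uj j) = uj_of j" by transfer simp
  have r: "real_partial c (uj_of j) p = (case c of ReUj i \<Rightarrow> if j = i then 1 else 0
      | ImUj i \<Rightarrow> if j = i then \<i> else 0 | _ \<Rightarrow> 0)" for c p
    by (rule real_partial_eqI, rule has_vector_derivative_coords)
  show "fn (pd c (uj j)) p = fn (if c = Uj j then 1 else 0) p" for p
    by (cases c) (auto simp: * r)
qed

lemma pd_zc [simp]: "pd c zc = (if c = Z then 1 else 0)"
proof (rule sfun_eqI)
  have *: "fn zc = z_of" by transfer simp
  have r: "real_partial c z_of p = (case c of ReZ \<Rightarrow> 1 | ImZ \<Rightarrow> \<i> | _ \<Rightarrow> 0)" for c p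
    by (rule real_partial_eqI, rule has_vector_derivative_coords)
  show "fn (pd c zc) p = fn (if c = Z then 1 else 0) p" for p
    by (cases c) (auto simp: * r)
qed

text \<open>The bound is exclusive: a function on M^(k) has level k + 1. Vanishing derivatives are
  used because they pass directly through derivatives and conjugation.\<close>

definition level :: "nat \<Rightarrow> sfun \<Rightarrow> bool" where
  "level k F \<longleftrightarrow> (\<forall>j\<ge>k. pd (Uj j) F = 0 \<and> pd (Ujbar j) F = 0)"

lemma levelD: "level k F \<Longrightarrow> k \<le> j \<Longrightarrow> pd (Uj j) F = 0" "level k F \<Longrightarrow> k \<le> j \<Longrightarrow> pd (Ujbar j) F = 0"
  by (auto simp: level_def)

lemma level_mono: "level k F \<Longrightarrow> k \<le> l \<Longrightarrow> level l F"
  by (auto simp: level_def)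

lemma level_of_smooth_fun_on: "smooth_fun_on k (fn F) \<Longrightarrow> level (Suc k) F"
  using partial_eq_0[OF smooth_fun_onD(1)]
  by (auto simp: level_def sfun_eq_iff)

lemma ex_level: obtains k where "level k F"
  using smooth_fun_fn[of F] level_of_smooth_fun_on unfolding smooth_fun_def by blast

lemma conj_coord_simps [simp]: "conj_coord (conj_coord c) = c" "conj_coord c = Z \<longleftrightarrow> c = Zbar"
  "conj_coord c = Zbar \<longleftrightarrow> c = Z" "conj_coord c = U \<longleftrightarrow> c = U"
  "conj_coord c = Uj j \<longleftrightarrow> c = Ujbar j" "conj_coord c = Ujbar j \<longleftrightarrow> c = Uj j"
  by (cases c; simp)+

lemma pd_U_0_indep: "pd U F = 0 \<Longrightarrow> fn F (z, u, w) = fn F (z, v, w)"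
  by (rule partial_U_0_constant) (auto simp: sfun_eq_iff)

section \<open>Vector fields\<close>

text \<open>The index map \<open>\<kappa>\<close> lets one definition serve the total derivatives,
  indexed by coordinates, and the fields in the u_i alone, indexed by numbers.\<close>

definition vf :: "'i set \<Rightarrow> ('i \<Rightarrow> coord) \<Rightarrow> ('i \<Rightarrow> sfun) \<Rightarrow> sfun \<Rightarrow> sfun" where
  "vf I \<kappa> X F = (\<Sum>i\<in>I. X i * pd (\<kappa> i) F)"

lemma vf_simps [simp]:
  "vf I \<kappa> X (F + G) = vf I \<kappa> X F + vf I \<kappa> X G"
  "vf I \<kappa> X (F - G) = vf I \<kappa> X F - vf I \<kappa> X G"
  "vf I \<kappa> X (- F) = - vf I \<kappa> X F"
  "vf I \<kappa> X (F * G) = vf I \<kappa> X F * G + F * vf I \<kappa> X G"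
  "vf I \<kappa> X 0 = 0" "vf I \<kappa> X 1 = 0" "vf I \<kappa> X (const a) = 0" "vf I \<kappa> X (of_nat n) = 0"
  by (simp_all add: vf_def algebra_simps sum.distrib sum_subtractf sum_distrib_left sum_negf)

lemma vf_sum: "vf I \<kappa> X (sum F A) = (\<Sum>x\<in>A. vf I \<kappa> X (F x))"
  by (induction A rule: infinite_finite_induct) simp_all

lemma pd_vf: "pd c (vf I \<kappa> X F) = vf I \<kappa> X (pd c F) + vf I \<kappa> (\<lambda>i. pd c (X i)) F"
  by (simp add: vf_def sum.distrib pd_commute[of c] add.commute)

text \<open>The second order parts of both compositions are double sums that differ only by swapping
  the summations, since partial derivatives commute.\<close>

lemma vf_commutator:
  "vf I \<kappa> X (vf I \<kappa> Y F) = vf I \<kappa> Y (vf I \<kappa> X F) + vf I \<kappa> (\<lambda>i. vf I \<kappa> X (Y i) - vf I \<kappa> Y (X i)) F"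
proof -
  have exp: "vf I \<kappa> X (vf I \<kappa> Y F) = (\<Sum>i\<in>I. vf I \<kappa> X (Y i) * pd (\<kappa> i) F)
      + (\<Sum>i\<in>I. \<Sum>j\<in>I. Y i * X j * pd (\<kappa> j) (pd (\<kappa> i) F))" for X Y
    unfolding vf_def[of I \<kappa> Y F] vf_sum vf_simps sum.distrib
    by (simp add: vf_def sum_distrib_left mult.assoc)
  have sym: "(\<Sum>i\<in>I. \<Sum>j\<in>I. Y i * X j * pd (\<kappa> j) (pd (\<kappa> i) F)) =
      (\<Sum>i\<in>I. \<Sum>j\<in>I. X i * Y j * pd (\<kappa> j) (pd (\<kappa> i) F))"
    by (subst sum.swap) (simp add: mult.commute pd_commute)
  show ?thesis
    unfolding exp[of X Y] exp[of Y X] sym vf_def[of I \<kappa> "\<lambda>i. vf I \<kappa> X (Y i) - vf I \<kappa> Y (X i)" F]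
    by (simp add: algebra_simps sum_subtractf)
qed

definition coords :: "nat \<Rightarrow> coord set" where
  "coords N = {Z, Zbar, U} \<union> Uj ` {..<N} \<union> Ujbar ` {..<N}"

lemma sum_coords:
  "sum g (coords N) = g Z + g Zbar + g U + (\<Sum>i<N. g (Uj i)) + (\<Sum>i<N. g (Ujbar i))"
proof -
  have "sum g (coords N) = sum g ({Z, Zbar, U} \<union> Uj ` {..<N}) + sum g (Ujbar ` {..<N})"
    unfolding coords_def by (rule sum.union_disjoint) auto
  also have "sum g ({Z, Zbar, U} \<union> Uj ` {..<N}) = sum g {Z, Zbar, U} + sum g (Uj ` {..<N})"
    by (rule sum.union_disjoint) auto
  finally show ?thesis
    by (simp add: sum.reindex inj_on_def add.assoc)
qed

section \<open>The functions $T^i$ as Bell-type polynomials\<close>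

text \<open>The recursion of \<open>T\<close> with a free sequence in place of (f, f', f'', ...), on
  which d/du acts as a shift. It is the sum over n of a_n times the partial Bell polynomial
  B_{i,n}(u_0, u_1, ...). The free sequence allows derivatives of f to be frozen at another value of
  u.\<close>

fun bell :: "(nat \<Rightarrow> sfun) \<Rightarrow> nat \<Rightarrow> sfun" where
  "bell a 0 = a 0"
| "bell a (Suc i) = (\<Sum>j = 0..i. of_nat (i choose j) * uj (i - j) * bell (\<lambda>n. a (Suc n)) j)"

lemma pd_bell_other:
  assumes "\<And>j. c \<noteq> Uj j" shows "pd c (bell a i) = bell (\<lambda>n. pd c (a n)) i"
  by (induction a i rule: bell.induct) (simp_all add: assms)

lemma bell_zero [simp]: "bell (\<lambda>n. 0) i = 0"
  by (induction "\<lambda>n::nat. 0::sfun" i rule: bell.induct) simp_all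

lemma bell_linear: "bell (\<lambda>n. x * a n + y * b n) i = x * bell a i + y * bell b i"
proof (induction i arbitrary: a b rule: less_induct)
  case (less i)
  show ?case
    by (cases i) (simp_all add: less algebra_simps sum.distrib sum_distrib_left)
qed

text \<open>The two points may differ in z and u; this is how \<open>u\<close> is later varied
  independently of the u_j.\<close>

lemma bell_cong_fn:
  assumes "\<And>n. fn (a n) p = fn (b n) p'" "\<And>j. uj_of j p = uj_of j p'"
  shows "fn (bell a i) p = fn (bell b i) p'"
  using assms(1)
proof (induction i arbitrary: a b rule: less_induct)
  case (less i)
  show ?case
    by (cases i) (auto simp: less.prems assms(2) intro!: sum.cong less.IH)
qed

lemma pd_bell_ge:
  assumes "\<And>n. pd (Uj j) (a n) = 0" "i \<le> j"
  shows "pd (Uj j) (bell a i) = 0"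
  using assms
proof (induction a i rule: bell.induct)
  case (2 a i)
  have "pd (Uj j) (bell (\<lambda>n. a (Suc n)) m) = 0" if "m \<in> {0..i}" for m
    using 2 that by auto
  then show ?case using 2(3) by (auto intro!: sum.neutral)
qed simp

lemma pd_bell_Suc:
  assumes "\<And>n. pd (Uj i) (a n) = 0"
  shows "pd (Uj i) (bell a (Suc i)) = a 1"
proof -
  have "pd (Uj i) (bell (\<lambda>n. a (Suc n)) m) = 0" if "m \<in> {0..i}" for m
    using that by (intro pd_bell_ge assms) auto
  then have "pd (Uj i) (bell a (Suc i)) =
      (\<Sum>j = 0..i. if j = 0 then a 1 else 0)"
    unfolding bell.simps(2) pd_sum
  proof (intro sum.cong refl)
    fix j assume j: "j \<in> {0..i}"
    then have "i - j = i \<longleftrightarrow> j = 0" by auto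
    then show "pd (Uj i) (of_nat (i choose j) * uj (i - j) * bell (\<lambda>n. a (Suc n)) j) = (if j = 0 then a 1 else 0)"
      using \<open>\<And>m. m \<in> {0..i} \<Longrightarrow> _\<close>[OF j] by auto
  qed
  then show ?thesis by simp
qed

text \<open>The variable u_i has two sources: the explicit factor in the summand j = 1, with
  binomial coefficient i + 1, and the top variable of the inner polynomial in the summand j = i + 1.
  For i = 0 these are the same summand.\<close>

lemma pd_bell_Suc_Suc:
  assumes "\<And>n j. pd (Uj j) (a n) = 0"
  shows "pd (Uj i) (bell a (Suc (Suc i))) = of_nat (i + 2) * uj 0 * a 2"
proof -
  let ?B = "bell (\<lambda>n. a (Suc n))"
  have a: "pd (Uj i) (a n) = 0" for n using assms .
  have 0: "pd (Uj i) (?B m) = 0" if "m \<le> i" for m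
    using that by (intro pd_bell_ge assms) auto
  have 1: "pd (Uj i) (?B (Suc i)) = a 2"
    using pd_bell_Suc[of i "\<lambda>n. a (Suc n)"] assms by (simp add: numeral_2_eq_2)
  have B1: "?B 1 = uj 0 * a 2" by (simp add: numeral_2_eq_2)
  have "pd (Uj i) (of_nat (Suc i choose j) * uj (Suc i - j) * ?B j) =
      (if j = 1 then of_nat (Suc i) * uj 0 * a 2 else 0) + (if j = Suc i then uj 0 * a 2 else 0)"
    if "j \<in> {0..Suc i}" for j
  proof -
    consider "j = 0" | "j = 1" "i = 0" | "j = 1" "i > 0" | "j > 1" "j \<le> i" | "j > 1" "j = Suc i"
      using \<open>j \<in> {0..Suc i}\<close> by force
    then show ?thesis
    proof cases
      case 2
      then show ?thesis using 1 B1 by (simp add: algebra_simps del: bell.simps(2))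
    next
      case 3
      then show ?thesis using 0[of 1] B1 by (simp del: bell.simps(2) add: mult.assoc)
    next
      case 4
      then show ?thesis using 0[of j] by auto
    next
      case 5
      then show ?thesis using 1 by (simp del: bell.simps(2))
    qed (auto simp: assms)
  qed
  then have "pd (Uj i) (bell a (Suc (Suc i))) =
    (\<Sum>j = 0..Suc i. (if j = 1 then of_nat (Suc i) * uj 0 * a 2 else 0) + (if j = Suc i then uj 0 * a 2 else 0))"
    unfolding bell.simps(2)[of a "Suc i"] pd_sum by (intro sum.cong refl)
  also have "\<dots> = of_nat (Suc i) * uj 0 * a 2 + uj 0 * a 2"
    unfolding sum.distrib by (subst (1 2) sum.delta) auto
  finally show ?thesis by (simp add: algebra_simps)
qed

text \<open>Repeated differentiation of a composite g(u(z)): \<open>\<delta>\<close> acts as d/dz,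
  u_j being the derivative of order j + 1 of u. Only u_j with j < i occur in
  \<open>bell a i\<close>, so a truncated derivation suffices for i \<le> N.\<close>

lemma bell_total_derivative:
  assumes "\<And>F G. \<delta> (F + G) = \<delta> F + \<delta> G" "\<And>F G. \<delta> (F * G) = \<delta> F * G + F * \<delta> G"
    and "\<And>j. j < N \<Longrightarrow> \<delta> (uj j) = uj (Suc j)"
    and "\<And>n. \<delta> (a n) = uj 0 * a (Suc n)" "i \<le> N"
  shows "\<delta> (bell a i) = bell a (Suc i)"
  using assms(4,5)
proof (induction a i rule: bell.induct)
  case (1 a)
  then show ?case by simp
next
  case (2 a m)
  let ?B = "bell (\<lambda>n. a (Suc n))"
  have \<delta>0: "\<delta> 0 = 0" using assms(1)[of 0 0] by simp
  have \<delta>1: "\<delta> 1 = 0" using assms(2)[of 1 1] by simp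
  have \<delta>n: "\<delta> (of_nat n) = 0" for n by (induction n) (simp_all add: \<delta>0 \<delta>1 assms(1))
  have \<delta>s: "\<delta> (sum F A) = (\<Sum>x\<in>A. \<delta> (F x))" for F :: "nat \<Rightarrow> sfun" and A
    by (induction A rule: infinite_finite_induct) (simp_all add: assms(1) \<delta>0)
  have IH: "\<delta> (?B j) = ?B (Suc j)" if "j \<le> m" for j
    using 2 that by (simp del: bell.simps)
  have "\<delta> (bell a (Suc m)) = (\<Sum>j = 0..m. of_nat (m choose j) * uj (Suc m - j) * ?B j) +
      (\<Sum>j = 0..m. of_nat (m choose j) * uj (m - j) * ?B (Suc j))"
    unfolding bell.simps(2)[of a m] \<delta>s sum.distrib[symmetric]
  proof (rule sum.cong[OF refl])
    fix j assume "j \<in> {0..m}"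
    then show "\<delta> (of_nat (m choose j) * uj (m - j) * ?B j) = of_nat (m choose j) * uj (Suc m - j) * ?B j +
      of_nat (m choose j) * uj (m - j) * ?B (Suc j)"
      using 2(3) by (simp add: assms(2,3) \<delta>n IH Suc_diff_le algebra_simps del: bell.simps)
  qed
  \<comment> \<open>The added summand j = m + 1 has binomial coefficient 0; it makes room for the
    index shift that ends in Pascal's rule.\<close>
  also have "(\<Sum>j = 0..m. of_nat (m choose j) * uj (Suc m - j) * ?B j) =
      (\<Sum>j = 0..Suc m. of_nat (m choose j) * uj (Suc m - j) * ?B j)"
    by (simp add: binomial_eq_0 del: bell.simps)
  also have "\<dots> = uj (Suc m) * ?B 0 + (\<Sum>j = 0..m. of_nat (m choose Suc j) * uj (m - j) * ?B (Suc j))"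
    by (subst sum.atLeast0_atMost_Suc_shift) (simp del: bell.simps)
  also have "uj (Suc m) * ?B 0 + (\<Sum>j = 0..m. of_nat (m choose Suc j) * uj (m - j) * ?B (Suc j)) +
      (\<Sum>j = 0..m. of_nat (m choose j) * uj (m - j) * ?B (Suc j)) = bell a (Suc (Suc m))"
    unfolding bell.simps(2)[of a "Suc m"] sum.atLeast0_atMost_Suc_shift
    by (simp add: sum.distrib[symmetric] algebra_simps del: bell.simps)
  finally show ?case .
qed

section \<open>Weighted homogeneous polynomials\<close>

text \<open>Polynomials in the u_j, with u_j of weight j + 1. All variables have positive weight, so
  weights up to 1 are explicit: nothing below 0, constants at 0, multiples of u_0 at 1. This
  controls the coefficients of the brackets on and below the diagonal.\<close>

inductive Pol :: "int \<Rightarrow> sfun \<Rightarrow> bool" where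
  zero: "Pol n 0"
| const: "Pol 0 (const a)"
| mult_uj: "Pol n F \<Longrightarrow> Pol (n + int j + 1) (uj j * F)"
| add: "Pol n F \<Longrightarrow> Pol n G \<Longrightarrow> Pol n (F + G)"

lemma Pol_neg: "Pol n F \<Longrightarrow> n < 0 \<Longrightarrow> F = 0"
  by (induction rule: Pol.induct) auto

lemma Pol_0: "Pol n F \<Longrightarrow> n = 0 \<Longrightarrow> \<exists>a. F = const a"
proof (induction rule: Pol.induct)
  case (zero n)
  then show ?case by (intro exI[of _ 0]) (simp add: sfun_eq_iff)
next
  case (mult_uj n F j)
  then have "F = 0" by (intro Pol_neg) auto
  then show ?case by (intro exI[of _ 0]) (simp add: sfun_eq_iff)
next
  case (add n F G)
  then show ?case by (metis fn_simps(3,7) sfun_eqI)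
qed auto

lemma Pol_1: "Pol n F \<Longrightarrow> n = 1 \<Longrightarrow> \<exists>a. F = const a * uj 0"
proof (induction rule: Pol.induct)
  case (zero n)
  then show ?case by (intro exI[of _ 0]) (simp add: sfun_eq_iff)
next
  case (mult_uj n F j)
  show ?case
  proof (cases "j = 0")
    case True
    then show ?thesis using mult_uj Pol_0 by (metis add_cancel_right_left int_ops(1) mult.commute group_cancel.rule0 add.commute)
  next
    case False
    then have "F = 0" using mult_uj by (intro Pol_neg) auto
    then show ?thesis by (intro exI[of _ 0]) (simp add: sfun_eq_iff)
  qed
next
  case (add n F G)
  then obtain a b where "F = const a * uj 0" "G = const b * uj 0" by blast
  then show ?case by (intro exI[of _ "a + b"]) (simp add: sfun_eq_iff algebra_simps)
qed auto

lemma Pol_const_mult: "Pol n F \<Longrightarrow> Pol n (const a * F)"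
proof (induction rule: Pol.induct)
  case (const b)
  have "const a * const b = const (a * b)" by (simp add: sfun_eq_iff)
  then show ?case by (simp add: Pol.const)
next
  case (mult_uj n F j)
  then show ?case by (subst mult.left_commute) (intro Pol.mult_uj)
qed (auto simp: algebra_simps intro: Pol.intros)

lemma Pol_mult: "Pol n F \<Longrightarrow> Pol m G \<Longrightarrow> Pol (n + m) (F * G)"
proof (induction rule: Pol.induct)
  case (mult_uj n F j)
  then have "Pol (n + m + int j + 1) (uj j * (F * G))" by (intro Pol.mult_uj)
  then show ?case by (simp add: algebra_simps)
next
  case (const a)
  then show ?case by (simp add: Pol_const_mult)
qed (auto simp: distrib_right intro: Pol.intros)

lemma Pol_sum: "(\<And>x. x \<in> A \<Longrightarrow> Pol n (F x)) \<Longrightarrow> Pol n (sum F A)"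
  by (induction A rule: infinite_finite_induct) (auto intro: Pol.intros)

lemma Pol_uminus: "Pol n F \<Longrightarrow> Pol n (- F)"
  using Pol_const_mult[of n F "-1"] by (metis fn_simps(5,6,7) mult_minus1 sfun_eqI)

lemma Pol_diff: "Pol n F \<Longrightarrow> Pol n G \<Longrightarrow> Pol n (F - G)"
  using Pol.add[OF _ Pol_uminus] by fastforce

lemma Pol_pd: "Pol n F \<Longrightarrow> Pol (n - int i - 1) (pd (Uj i) F)"
proof (induction rule: Pol.induct)
  case (mult_uj n F j)
  then have "Pol ((n - int i - 1) + int j + 1) (uj j * pd (Uj i) F)" by (intro Pol.mult_uj)
  then have 1: "Pol (n + int j + 1 - int i - 1) (uj j * pd (Uj i) F)" by (simp add: algebra_simps)
  then show ?case using mult_uj by (cases "i = j") (auto simp: algebra_simps intro: Pol.add)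
qed (auto intro: Pol.intros)

lemma Pol_of_nat_mult: "Pol n F \<Longrightarrow> Pol n (of_nat k * F)"
  using Pol_const_mult[of n F "of_nat k"] by (metis fn_of_nat fn_simps(7) sfun_eqI)

lemma Pol_bell: "Pol (int i) (bell (\<lambda>n. const (a n)) i)"
proof (induction i arbitrary: a rule: less_induct)
  case (less i)
  show ?case
  proof (cases i)
    case 0
    then show ?thesis by (simp add: Pol.const)
  next
    case (Suc k)
    have "Pol (int i) (of_nat (k choose j) * uj (k - j) * bell (\<lambda>n. const (a (Suc n))) j)" if "j \<in> {0..k}" for j
    proof -
      have "Pol (int j + int (k - j) + 1) (uj (k - j) * bell (\<lambda>n. const (a (Suc n))) j)"
        using that Suc by (intro Pol.mult_uj less.IH) auto
      moreover have "int j + int (k - j) + 1 = int i" using that Suc by auto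
      ultimately show ?thesis using Pol_of_nat_mult by (simp add: mult.assoc)
    qed
    then show ?thesis unfolding Suc bell.simps(2) by (intro Pol_sum) simp
  qed
qed

section \<open>The total derivatives of the equation\<close>

locale poisson =
  fixes f :: "real \<Rightarrow> real"
  assumes smooth: "\<And>n x. ((deriv ^^ n) f) differentiable (at x)"
    and independent: "\<And>a b c :: real.
      (\<And>u. a * f u + b * deriv f u + c * deriv (deriv f) u = 0) \<Longrightarrow> a = 0 \<and> b = 0 \<and> c = 0"
begin

definition fu :: "nat \<Rightarrow> sfun" where
  "fu n = Sfun (\<lambda>p. of_real ((deriv ^^ n) f (u_of p)))"

lemma smooth_deriv: "((deriv ^^ m) ((deriv ^^ n) f)) differentiable (at x)"
  using smooth[of "m + n"] by (simp add: funpow_add o_def)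

lemma fn_fu: "fn (fu n) = (\<lambda>p. of_real ((deriv ^^ n) f (u_of p)))"
  unfolding fu_def
  by (rule Sfun_inverse) (use smooth_fun_on_comp_u[of "(deriv ^^ n) f"] smooth_deriv in \<open>auto simp: smooth_fun_def\<close>)

lemma pd_fu [simp]: "pd c (fu n) = (if c = U then fu (Suc n) else 0)"
proof (rule sfun_eqI)
  have r: "real_partial c (fn (fu n)) p = (if c = RealU then fn (fu (Suc n)) p else 0)" for c p
    unfolding fn_fu using has_vector_derivative_of_real_comp[OF smooth[of n "u_of p"], of c]
    by (cases "c = RealU") (auto intro!: real_partial_eqI)
  show "fn (pd c (fu n)) p = fn (if c = U then fu (Suc n) else 0) p" for p
    by (cases c) (auto simp: r)
qed

lemma cj_fu [simp]: "cj (fu n) = fu n"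
  by (rule sfun_eqI) (simp add: fn_fu)

definition Ts :: "nat \<Rightarrow> sfun" where "Ts i = bell fu i"

lemma Ts_0 [simp]: "Ts 0 = fu 0" and Ts_1: "Ts (Suc 0) = uj 0 * fu 1"
  by (simp_all add: Ts_def)

lemma pd_U_Ts: "pd U (Ts i) = bell (\<lambda>n. fu (Suc n)) i"
  by (simp add: Ts_def pd_bell_other)

lemma fn_Ts: "fn (Ts i) = T f i"
proof (induction i rule: less_induct)
  case (less i)
  show ?case
  proof (cases i)
    case 0
    then show ?thesis by (simp add: fn_fu)
  next
    case (Suc k)
    have "partial U (T f j) p = fn (bell (\<lambda>n. fu (Suc n)) j) p" if "j \<le> k" for j p
      using less[of j] that Suc by (metis fn_simps(9) less_Suc_eq_le pd_U_Ts)
    then show ?thesis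
      unfolding Suc by (auto simp: Ts_def fun_eq_iff intro!: sum.cong)
  qed
qed

lemma pd_Ts [simp]: "pd Z (Ts i) = 0" "pd Zbar (Ts i) = 0" "pd (Ujbar j) (Ts i) = 0"
  "i \<le> j \<Longrightarrow> pd (Uj j) (Ts i) = 0" "pd (Uj i) (Ts (Suc i)) = fu 1"
  "pd (Uj i) (Ts (Suc (Suc i))) = of_nat (i + 2) * uj 0 * fu 2"
  by (simp_all add: Ts_def pd_bell_other pd_bell_ge pd_bell_Suc pd_bell_Suc_Suc del: bell.simps)

fun Dv :: "coord \<Rightarrow> sfun" where
  "Dv Z = 1" | "Dv Zbar = 0" | "Dv U = uj 0" | "Dv (Uj i) = uj (Suc i)" | "Dv (Ujbar i) = - cj (Ts i)"

definition Dbv :: "coord \<Rightarrow> sfun" where "Dbv c = cj (Dv (conj_coord c))"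

text \<open>
  \<open>D N\<close> and \<open>Db N\<close> are $e_{-1}$ and $e_{\overline{-1}}$ without the terms $\partial_{u_i}$, $\partial_{\bar u_i}$
  for $i \ge N$: derivations of the whole ring, which agree with the full fields on functions of level \<open>N\<close>.
\<close>

abbreviation D :: "nat \<Rightarrow> sfun \<Rightarrow> sfun" where "D N \<equiv> vf (coords N) (\<lambda>c. c) Dv"
abbreviation Db :: "nat \<Rightarrow> sfun \<Rightarrow> sfun" where "Db N \<equiv> vf (coords N) (\<lambda>c. c) Dbv"

lemma Dbv_simps [simp]: "Dbv Z = 0" "Dbv Zbar = 1" "Dbv U = cj (uj 0)" "Dbv (Uj i) = - Ts i"
  "Dbv (Ujbar i) = cj (uj (Suc i))"
  by (simp_all add: Dbv_def)

lemma D_eq: "D N F = pd Z F + uj 0 * pd U F + (\<Sum>i<N. uj (Suc i) * pd (Uj i) F)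
    - (\<Sum>i<N. cj (Ts i) * pd (Ujbar i) F)"
  by (simp add: vf_def sum_coords sum_negf)

lemma Db_eq: "Db N F = pd Zbar F + cj (uj 0) * pd U F + (\<Sum>i<N. cj (uj (Suc i)) * pd (Ujbar i) F)
    - (\<Sum>i<N. Ts i * pd (Uj i) F)"
  by (simp add: vf_def sum_coords sum_negf)

lemma Db_cj: "Db N (cj F) = cj (D N F)"
  unfolding D_eq Db_eq by (simp add: pd_cj cj_sum)

lemma D_cj: "D N (cj F) = cj (Db N F)"
  unfolding D_eq Db_eq by (simp add: pd_cj cj_sum)

lemma D_uj: "j < N \<Longrightarrow> D N (uj j) = uj (Suc j)"
  by (simp add: D_eq pd_cj mult_delta_left mult_delta_right)

lemma Db_uj: "j < N \<Longrightarrow> Db N (uj j) = - Ts j"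
  by (simp add: Db_eq pd_cj mult_delta_left mult_delta_right)

lemma D_fu: "D N (fu n) = uj 0 * fu (Suc n)" and Db_fu: "Db N (fu n) = cj (uj 0) * fu (Suc n)"
  by (simp_all add: D_eq Db_eq)

lemma D_Ts: "i \<le> N \<Longrightarrow> D N (Ts i) = Ts (Suc i)"
  unfolding Ts_def
  by (rule bell_total_derivative[where N = N]) (simp_all add: D_uj D_fu del: One_nat_def)

text \<open>At d/du_i the commutator has coefficient -T^{i+1} + T^{i+1}, and at d/du the two values
  of f cancel because f is real. Truncation spoils the cancellation only at i = N - 1, where K < N
  makes the derivative of \<open>F\<close> vanish.\<close>

lemma D_Db_commute:
  assumes "level K F" "K < N" shows "D N (Db N F) = Db N (D N F)"
proof -
  have 0: "(D N (Dbv c) - Db N (Dv c)) * pd c F = 0" if "c \<in> coords N" for c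
  proof (cases c)
    case (Uj i)
    with that have i: "i < N" by (auto simp: coords_def)
    show ?thesis
    proof (cases "Suc i < N")
      case True
      then show ?thesis using i by (simp add: Uj D_Ts Db_uj)
    next
      case False
      then show ?thesis using levelD(1)[OF assms(1), of i] assms(2) by (simp add: Uj)
    qed
  next
    case (Ujbar i)
    with that have i: "i < N" by (auto simp: coords_def)
    show ?thesis
    proof (cases "Suc i < N")
      case True
      then show ?thesis using i by (simp add: Ujbar D_cj Db_cj D_Ts Db_uj)
    next
      case False
      then show ?thesis using levelD(2)[OF assms(1), of i] assms(2) by (simp add: Ujbar)
    qed
  qed (use assms(2) in \<open>simp_all add: D_cj Db_uj\<close>)
  show ?thesis
    unfolding vf_commutator[of "coords N" "\<lambda>c. c" Dv Dbv F]
    by (simp add: vf_def[of _ _ "\<lambda>i. _ i - _ i"] 0)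
qed

text \<open>The commutator of d/du_j with e_{-1} is the derivative along \<open>prev j\<close>; the
  coordinate u plays the role of u_{-1}.\<close>

fun prev :: "nat \<Rightarrow> coord" where "prev 0 = U" | "prev (Suc j) = Uj j"

lemma pd_Uj_D: "j \<le> N \<Longrightarrow> pd (Uj j) (D N F) = D N (pd (Uj j) F) + pd (prev j) F"
  unfolding pd_vf by (cases j) (auto simp: vf_def sum_coords pd_cj mult_delta_left mult_delta_right)

lemma pd_Uj_Db: "pd (Uj j) (Db N F) = Db N (pd (Uj j) F) - (\<Sum>i<N. pd (Uj j) (Ts i) * pd (Uj i) F)"
  unfolding pd_vf by (simp add: vf_def sum_coords pd_cj sum_negf)

end

section \<open>Solutions of the linearized equation\<close>

lemma of_nat_mult_eq_0_sfun: "of_nat (Suc n) * F = (0 :: sfun) \<longleftrightarrow> F = 0"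
proof -
  have "of_nat (Suc n) \<noteq> (0 :: complex)" by (simp only: of_nat_eq_0_iff)
  then show ?thesis by (simp add: sfun_eq_iff del: of_nat_Suc)
qed

section \<open>Jets of f, brackets, and the kernel of the first order equations\<close>

context poisson
begin

text \<open>If all these determinants vanish, fixing v gives a linear relation between f' and f''.
  Independence makes its coefficient f'(v) zero for every v, so f' vanishes identically, which
  independence excludes as well.\<close>

lemma ex_jets_independent:
  "\<exists>v w. deriv f v * deriv (deriv f) w - deriv f w * deriv (deriv f) v \<noteq> 0"
proof (rule ccontr)
  assume "\<not> ?thesis"
  then have 0: "deriv f v * deriv (deriv f) w - deriv f w * deriv (deriv f) v = 0" for v w by blast
  have "0 * f u + (- deriv (deriv f) v) * deriv f u + deriv f v * deriv (deriv f) u = 0" for u v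
    using 0[of v u] by (simp add: algebra_simps)
  then have "deriv f v = 0" for v using independent by blast
  then have "0 * f u + 1 * deriv f u + 0 * deriv (deriv f) u = 0" for u by simp
  then show False using independent by (metis zero_neq_one)
qed

text \<open>The jet starts at f', not at f, because the equation is differentiated once in u before
  it is evaluated.\<close>

definition jet_u :: "real \<Rightarrow> nat \<Rightarrow> real" where "jet_u v n = (deriv ^^ Suc n) f v"

lemma ex_jet_combination:
  fixes x y :: real
  obtains v w s t where "s * jet_u v 0 + t * jet_u w 0 = x" "s * jet_u v 1 + t * jet_u w 1 = y"
proof -
  obtain v w where d: "deriv f v * deriv (deriv f) w - deriv f w * deriv (deriv f) v \<noteq> 0"
    using ex_jets_independent by blast
  \<comment> \<open>Cramer's rule for the 2 x 2 system with columns (f'(v), f''(v)) and (f'(w),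
    f''(w)).\<close>
  define \<Delta> where "\<Delta> = deriv f v * deriv (deriv f) w - deriv f w * deriv (deriv f) v"
  define s where "s = (x * deriv (deriv f) w - y * deriv f w) / \<Delta>"
  define t where "t = (y * deriv f v - x * deriv (deriv f) v) / \<Delta>"
  have "\<Delta> \<noteq> 0" using d by (simp add: \<Delta>_def)
  then have "s * \<Delta> = x * deriv (deriv f) w - y * deriv f w" "t * \<Delta> = y * deriv f v - x * deriv (deriv f) v"
    by (simp_all add: s_def t_def)
  then have "(s * deriv f v + t * deriv f w) * \<Delta> = x * \<Delta>"
    "(s * deriv (deriv f) v + t * deriv (deriv f) w) * \<Delta> = y * \<Delta>"
    unfolding \<Delta>_def by algebra+
  then show ?thesis
    using that[of s v t w] \<open>\<Delta> \<noteq> 0\<close> by (simp add: jet_u_def)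
qed

abbreviation uvf :: "nat \<Rightarrow> (nat \<Rightarrow> sfun) \<Rightarrow> sfun \<Rightarrow> sfun" where
  "uvf N \<equiv> vf {..<N} Uj"

abbreviation bell_real :: "(nat \<Rightarrow> real) \<Rightarrow> nat \<Rightarrow> sfun" where
  "bell_real a \<equiv> bell (\<lambda>n. const (of_real (a n)))"

text \<open>
  If $R$ does not involve $u$, the equation for $e_{\overline{-1}} R$ may be differentiated in $u$ and then
  evaluated at arbitrary values of $u$, independently of the other coordinates. Linear combinations of
  these evaluations prescribe the first two entries of the jet that replaces $(f', f'', \ldots)$.
\<close>

lemma jet_equation:
  assumes R: "pd U R = 0" "\<And>j. pd (Ujbar j) R = 0"
    and E: "Db N R = fu 1 * s + uj 0 * fu 2 * q"
    and s: "pd U s = 0" and q: "pd U q = 0"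
  obtains a where "a 0 = x" "a 1 = y"
    "uvf N (bell_real a) R = - (const (of_real (a 1)) * s + const (of_real (a 2)) * (uj 0 * q))"
proof -
  have R': "pd U (pd (Uj i) R) = 0" "pd U (pd Zbar R) = 0" for i
    using R(1) by (simp_all add: pd_commute[of U])
  have "pd U (Db N R) = fu 2 * s + uj 0 * fu 3 * q"
    unfolding E by (simp add: s q numeral_2_eq_2 numeral_3_eq_3)
  \<comment> \<open>On the left \<open>u\<close> occurs only inside the T^i, so the differentiation
    also removes the term with d/d(conj z).\<close>
  moreover have "pd U (Db N R) = - (\<Sum>i<N. bell (\<lambda>n. fu (Suc n)) i * pd (Uj i) R)"
    unfolding Db_eq by (simp add: R R' pd_U_Ts del: bell.simps)
  ultimately have dE: "(\<Sum>i<N. bell (\<lambda>n. fu (Suc n)) i * pd (Uj i) R) = - (fu 2 * s + uj 0 * fu 3 * q)"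
    by (metis minus_minus)
  have at: "(\<Sum>i<N. bell_real (jet_u v) i * pd (Uj i) R)
      = - (const (of_real (jet_u v 1)) * s + const (of_real (jet_u v 2)) * (uj 0 * q))" for v
  proof (rule sfun_eqI)
    fix p :: jet
    obtain z u w where p: "p = (z, u, w)" by (cases p)
    let ?p = "(z, v, w)"
    have ind: "fn F p = fn F ?p" if "pd U F = 0" for F
      unfolding p by (rule pd_U_0_indep[OF that])
    \<comment> \<open>The derivatives of f at v appear as constants on one side and through the
      coordinate u = v of \<open>?p\<close> on the other.\<close>
    have B: "fn (bell_real (jet_u v) i) p = fn (bell (\<lambda>n. fu (Suc n)) i) ?p" for i
      by (rule bell_cong_fn) (simp_all add: p fn_fu jet_u_def u_of_def uj_of_def)
    have "fn (\<Sum>i<N. bell_real (jet_u v) i * pd (Uj i) R) p = fn (\<Sum>i<N. bell (\<lambda>n. fu (Suc n)) i * pd (Uj i) R) ?p"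
      unfolding fn_sum by (simp only: fn_simps(6) B ind[OF R'(1)])
    also have "\<dots> = - (fn (fu 2) ?p * fn s p + uj_of 0 p * fn (fu 3) ?p * fn q p)"
      unfolding dE ind[OF s] ind[OF q] by (simp add: p uj_of_def)
    also have "\<dots> = fn (- (const (of_real (jet_u v 1)) * s + const (of_real (jet_u v 2)) * (uj 0 * q))) p"
      by (simp add: fn_fu jet_u_def u_of_def numeral_2_eq_2 numeral_3_eq_3 algebra_simps)
    finally show "fn (\<Sum>i<N. bell_real (jet_u v) i * pd (Uj i) R) p = \<dots>" .
  qed
  obtain v w \<sigma> \<tau> where vw: "\<sigma> * jet_u v 0 + \<tau> * jet_u w 0 = x" "\<sigma> * jet_u v 1 + \<tau> * jet_u w 1 = y"
    by (rule ex_jet_combination)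
  \<comment> \<open>Entries 0 and 1 are prescribed; a_2, a_3, ... are whatever the combination
    yields, and a_2 remains as an unknown constant.\<close>
  define a where "a n = \<sigma> * jet_u v n + \<tau> * jet_u w n" for n
  have a: "const (of_real (a n)) = const \<sigma> * const (of_real (jet_u v n)) + const \<tau> * const (of_real (jet_u w n))" for n
    by (simp add: a_def sfun_eq_iff)
  have "uvf N (bell_real a) R = const \<sigma> * (\<Sum>i<N. bell_real (jet_u v) i * pd (Uj i) R) + const \<tau> * (\<Sum>i<N. bell_real (jet_u w) i * pd (Uj i) R)"
    unfolding a bell_linear vf_def by (simp add: sum_distrib_left sum.distrib distrib_right mult.assoc)
  also have "\<dots> = - (const (of_real (a 1)) * s + const (of_real (a 2)) * (uj 0 * q))"
    unfolding at a by (simp add: algebra_simps)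
  finally have "uvf N (bell_real a) R = - (const (of_real (a 1)) * s + const (of_real (a 2)) * (uj 0 * q))" .
  moreover have "a 0 = x" "a 1 = y" using vw by (simp_all add: a_def)
  ultimately show ?thesis using that by blast
qed

fun bracket :: "nat \<Rightarrow> (nat \<Rightarrow> sfun) \<Rightarrow> (nat \<Rightarrow> sfun) \<Rightarrow> nat \<Rightarrow> nat \<Rightarrow> sfun" where
  "bracket N A B 0 = B"
| "bracket N A B (Suc r) = (\<lambda>i. uvf N A (bracket N A B r i) - uvf N (bracket N A B r) (A i))"

lemma uvf_bracket_Suc:
  "uvf N (bracket N A B (Suc r)) F = uvf N A (uvf N (bracket N A B r) F) - uvf N (bracket N A B r) (uvf N A F)"
  using vf_commutator[of "{..<N}" Uj A "bracket N A B r" F] by simp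

lemma Pol_uvf:
  assumes "\<And>i. Pol (int i - k) (X i)" "Pol n F"
  shows "Pol (n - k - 1) (uvf N X F)"
  unfolding vf_def
proof (rule Pol_sum)
  fix i
  have "Pol ((int i - k) + (n - int i - 1)) (X i * pd (Uj i) F)"
    by (intro Pol_mult Pol_pd assms)
  then show "Pol (n - k - 1) (X i * pd (Uj i) F)" by (simp add: algebra_simps)
qed

lemma Pol_bracket: "Pol (int i - int r) (bracket N (bell_real a) (bell_real b) r i)"
proof (induction r arbitrary: i)
  case 0
  then show ?case by (simp add: Pol_bell)
next
  case (Suc r)
  have "Pol (int i - int r - 0 - 1) (uvf N (bell_real a) (bracket N (bell_real a) (bell_real b) r i))"
    by (intro Pol_uvf Suc) (simp add: Pol_bell)
  moreover have "Pol (int i - int r - 1) (uvf N (bracket N (bell_real a) (bell_real b) r) (bell_real a i))"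
    by (intro Pol_uvf Suc Pol_bell)
  ultimately show ?case by (simp add: Pol_diff algebra_simps)
qed

lemma bracket_lower: "i < r \<Longrightarrow> bracket N (bell_real a) (bell_real b) r i = 0"
  using Pol_neg[OF Pol_bracket] by simp

text \<open>The new diagonal entry is X_a(Y_r^{r+1}) - Y_r(X_a^{r+1}). The coefficient Y_r^{r+1} has
  weight 1, hence is a multiple of u_0, and X_a annihilates u_0 as a_0 = 0. In the second term only
  i = r survives, with factor a_1 = 1, so each bracket flips the sign.\<close>

lemma bracket_diagonal:
  assumes "a 0 = 0" "a 1 = 1" "b 0 = 1" "r < N"
  shows "bracket N (bell_real a) (bell_real b) r r = (- 1) ^ r"
  using assms(4)
proof (induction r)
  case 0
  have "const 1 = 1" by (simp add: sfun_eq_iff)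
  then show ?case by (simp add: assms)
next
  case (Suc r)
  let ?y = "bracket N (bell_real a) (bell_real b) r"
  have c: "const 1 = 1" "const 0 = 0" by (simp_all add: sfun_eq_iff)
  obtain d where d: "?y (Suc r) = const d * uj 0"
    using Pol_1[OF Pol_bracket] by fastforce
  have "uvf N (bell_real a) (?y (Suc r)) = const d * (\<Sum>i<N. bell_real a i * (if i = 0 then 1 else 0))"
    unfolding d vf_simps by (simp add: vf_def)
  also have "\<dots> = 0" using Suc by (simp add: mult_delta_right assms c)
  finally have 1: "uvf N (bell_real a) (?y (Suc r)) = 0" .
  have "?y i * pd (Uj i) (bell_real a (Suc r)) = (if i = r then (- 1) ^ r else 0)" for i
  proof -
    consider "i < r" | "i = r" | "i > r" by linarith
    then show ?thesis
    proof cases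
      case 1
      then show ?thesis by (simp add: bracket_lower)
    next
      case 2
      then show ?thesis using Suc assms(2) by (simp add: pd_bell_Suc c del: bell.simps)
    next
      case 3
      then show ?thesis by (simp add: pd_bell_ge del: bell.simps)
    qed
  qed
  then have "uvf N ?y (bell_real a (Suc r)) = (- 1) ^ r"
    using Suc unfolding vf_def by simp
  with 1 show ?case by simp
qed


text \<open>
  The brackets $Y_0 = X_b$, $Y_{r+1} = [X_a, Y_r]$ of the fields from \<open>jet_equation\<close> have polynomial
  coefficients of weight $i - r$ at $\partial_{u_i}$, so they are triangular with diagonal $(-1)^r$.
\<close>

lemma kernel_lemma:
  assumes R: "pd U R = 0" "\<And>j. pd (Ujbar j) R = 0" "level N R" and N: "2 \<le> N"
    and E: "Db N R = fu 1 * s + uj 0 * fu 2 * q"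
    and s: "\<And>c. c \<noteq> Z \<Longrightarrow> c \<noteq> Zbar \<Longrightarrow> pd c s = 0"
    and q: "\<And>c. c \<noteq> Z \<Longrightarrow> pd c q = 0"
  shows "q = 0" "pd (Uj i) R = 0"
proof -
  have U: "pd U s = 0" "pd U q = 0" using s q by simp_all
  \<comment> \<open>X_a has no component along d/du_0. X_b has coefficient 1 there and none along
    d/du_1, and b_1 = 0 removes s from its equation.\<close>
  obtain a where a: "a 0 = 0" "a 1 = 1"
    and A: "uvf N (bell_real a) R = - (const (of_real (a 1)) * s + const (of_real (a 2)) * (uj 0 * q))"
    by (rule jet_equation[OF R(1,2) E U, where x = 0 and y = 1])
  obtain b where b: "b 0 = 1" "b 1 = 0"
    and B: "uvf N (bell_real b) R = - (const (of_real (b 1)) * s + const (of_real (b 2)) * (uj 0 * q))"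
    by (rule jet_equation[OF R(1,2) E U, where x = 1 and y = 0])
  have c: "const 1 = 1" "const 0 = 0" by (simp_all add: sfun_eq_iff)
  define y where "y = bracket N (bell_real a) (bell_real b)"
  have sq: "uvf N X s = 0" "uvf N X q = 0" for X
    using s q by (simp_all add: vf_def)
  have u0: "uvf N X (uj 0) = X 0" for X
    using N by (simp add: vf_def mult_delta_right)
  have A: "uvf N (bell_real a) R = - (s + const (of_real (a 2)) * (uj 0 * q))"
    unfolding A a by (simp add: c)
  have Y0: "uvf N (y 0) R = - (const (of_real (b 2)) * (uj 0 * q))"
    using B by (simp add: y_def b[unfolded One_nat_def] c)
  \<comment> \<open>Fields in the u_i annihilate s and q, so applied to X_a R they only see the
    factor u_0.\<close>
  have Ya: "uvf N X (uvf N (bell_real a) R) = - (const (of_real (a 2)) * (X 0 * q))" for X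
    unfolding A by (simp add: sq u0)
  \<comment> \<open>X_a(X_b R) vanishes because X_a u_0 = 0; the other order survives because X_b
    u_0 = 1.\<close>
  have Y1: "uvf N (y 1) R = const (of_real (a 2)) * q"
    unfolding y_def One_nat_def uvf_bracket_Suc
    unfolding y_def[symmetric] Y0 Ya
    by (simp add: sq u0 a c) (simp add: y_def b c)
  \<comment> \<open>Y_1 R is a constant times q, which X_a annihilates, and Y_r with r \<ge> 1 has
    no component along d/du_0. Hence every further bracket annihilates R.\<close>
  have Y2: "uvf N (y (Suc (Suc r))) R = 0" for r
  proof (induction r)
    case 0
    show ?case unfolding y_def uvf_bracket_Suc[of _ _ _ "Suc 0"]
      unfolding y_def[symmetric] Y1[unfolded One_nat_def] Ya
      by (simp add: sq) (simp add: y_def bracket_lower del: bracket.simps)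
  next
    case (Suc r)
    show ?case unfolding y_def uvf_bracket_Suc[of _ _ _ "Suc (Suc r)"]
      unfolding y_def[symmetric] Suc Ya
      by (simp add: y_def bracket_lower del: bracket.simps)
  qed
  have tri: "uvf N (y r) R = (- 1) ^ r * pd (Uj r) R"
    if "r < N" "\<And>j. j > r \<Longrightarrow> y r j * pd (Uj j) R = 0" for r
  proof -
    have "y r i * pd (Uj i) R = (if i = r then (- 1) ^ r * pd (Uj r) R else 0)" for i
      using that(2)[of i] bracket_lower[of i r] bracket_diagonal[of a b r N, OF a b(1) that(1)]
      by (cases i r rule: linorder_cases) (simp_all add: y_def)
    then show ?thesis using that(1) by (simp add: vf_def)
  qed
  have R2: "pd (Uj i) R = 0" if "2 \<le> i" for i
    using that
  proof (induction "N - i" arbitrary: i rule: less_induct)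
    case less
    show ?case
    proof (cases "i < N")
      case True
      have "pd (Uj j) R = 0" if "j > i" for j
      proof (cases "j < N")
        case True
        then show ?thesis using less that by auto
      next
        case False
        then show ?thesis using levelD(1)[OF R(3)] by simp
      qed
      then have "uvf N (y i) R = (- 1) ^ i * pd (Uj i) R" using True by (intro tri) auto
      moreover obtain r where "i = Suc (Suc r)"
        using less.prems by (metis add_2_eq_Suc le_Suc_ex)
      ultimately have "(- 1) ^ i * pd (Uj i) R = 0" using Y2 by simp
      then have "(- 1) ^ i * ((- 1) ^ i * pd (Uj i) R) = 0" by simp
      then show ?thesis by (simp add: mult.assoc[symmetric] power_mult_distrib[symmetric])
    next
      case False
      then show ?thesis using levelD(1)[OF R(3)] by simp
    qed
  qed
  have "uvf N (y 1) R = - pd (Uj 1) R"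
    using tri[of 1] R2 N by simp
  then have R1: "pd (Uj 1) R = - (const (of_real (a 2)) * q)"
    using Y1 by (metis minus_minus)
  \<comment> \<open>At j = 1 it is the coefficient u_0 b_1 = 0 that helps, since R_{u_1} is not yet
    known to vanish.\<close>
  have "y 0 j * pd (Uj j) R = 0" if "j > 0" for j
    using R2[of j] that by (cases "j = 1") (auto simp: y_def b[unfolded One_nat_def] c)
  then have R0: "pd (Uj 0) R = - (const (of_real (b 2)) * (uj 0 * q))"
    using tri[of 0] N Y0 by simp
  have "(\<Sum>i<N. Ts i * pd (Uj i) R) = (\<Sum>i<2. Ts i * pd (Uj i) R)"
    by (rule sum.mono_neutral_right) (use N R2 in auto)
  also have "\<dots> = fu 0 * pd (Uj 0) R + uj 0 * fu 1 * pd (Uj 1) R"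
    by (simp add: numeral_2_eq_2 Ts_1)
  finally have "Db N R = pd Zbar R - (fu 0 * pd (Uj 0) R + uj 0 * fu 1 * pd (Uj 1) R)"
    unfolding Db_eq by (simp add: R(1,2))
  \<comment> \<open>Differentiation in u had removed f itself. The original equation brings it back,
    and its u_0-derivative compares f'' q with b_2 f q + a_2 f' q.\<close>
  then have "pd (Uj 0) (fu 1 * s + uj 0 * fu 2 * q) =
      pd Zbar (pd (Uj 0) R) - pd (Uj 0) (fu 0 * pd (Uj 0) R + uj 0 * fu 1 * pd (Uj 1) R)"
    unfolding E by (simp add: pd_commute)
  then have q_eq: "(fu 2 - const (of_real (b 2)) * fu 0 - const (of_real (a 2)) * fu 1) * q = 0"
    unfolding R0 R1 by (simp add: s q algebra_simps)
  show q0: "q = 0"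
  proof (rule ccontr)
    assume "q \<noteq> 0"
    then obtain z u w where p: "fn q (z, u, w) \<noteq> 0" by (auto simp: sfun_eq_iff)
    have "(- b 2) * f v + (- a 2) * deriv f v + 1 * deriv (deriv f) v = 0" for v
    proof -
      have "fn q (z, v, w) \<noteq> 0" using p pd_U_0_indep[of q z u w v] q by simp
      moreover have "fn ((fu 2 - const (of_real (b 2)) * fu 0 - const (of_real (a 2)) * fu 1) * q) (z, v, w) = 0"
        unfolding q_eq by simp
      ultimately have "complex_of_real (deriv (deriv f) v - b 2 * f v - a 2 * deriv f v) = 0"
        by (simp add: fn_fu u_of_def numeral_2_eq_2)
      then show ?thesis unfolding of_real_eq_0_iff by simp
    qed
    then show False using independent by (metis zero_neq_one)
  qed
  have "pd (Uj 0) R = 0" "pd (Uj 1) R = 0"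
    using R0 R1 q0 by simp_all
  then show "pd (Uj i) R = 0"
    using R2[of i] by (cases "i = 0"; cases "i = 1") auto
qed

end

lemma level_pd: "level k F \<Longrightarrow> level k (pd c F)"
  by (simp add: level_def pd_commute[of _ c])

lemma level_cj: "level k F \<Longrightarrow> level k (cj F)"
  by (auto simp: level_def pd_cj)

lemma level_0 [simp]: "level k 0"
  by (simp add: level_def)

section \<open>Descent from the highest derivative to the general solution\<close>

context poisson
begin

text \<open>
  The highest derivative $P_{u_k}$ turns out to be a holomorphic function $q$ of $z$, and then so is
  $P_{u_{k-1}}$. The next coefficient of the equation reads
  $e_{\overline{-1}} P_{u_{k-2}} = f' q_z + (k + 1) u_0 f'' q$ (with $P_u = 0$ in place of $P_{u_{-1}}$),
  which forces $q = 0$.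
\<close>

lemma top_coefficient:
  assumes P: "pd U P = 0" "\<And>i j. pd (Ujbar j) (pd (Uj i) P) = 0" "level N P"
    and E: "Db N (D N P) + fu 1 * P = 0"
    and top: "\<And>j. j > k \<Longrightarrow> pd (Uj j) P = 0" and k: "k + 2 \<le> N"
  shows "c \<noteq> Z \<Longrightarrow> pd c (pd (Uj k) P) = 0" "0 < k \<Longrightarrow> pd (Uj k) P = 0"
proof -
  \<comment> \<open>\<open>Q i\<close> is the u_i-derivative of \<open>D N P\<close>, rewritten by
    the commutator; \<open>dE\<close> is then the u_j-derivative of the equation.\<close>
  define Q where "Q i = D N (pd (Uj i) P) + pd (prev i) P" for i
  have dE: "Db N (Q j) - (\<Sum>i<N. pd (Uj j) (Ts i) * Q i) + fu 1 * pd (Uj j) P = 0" if "j \<le> N" for j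
  proof -
    have "pd (Uj j) (Db N (D N P) + fu 1 * P) = 0" using E by simp
    then show ?thesis
      by (simp add: pd_Uj_Db pd_Uj_D[OF that] pd_Uj_D Q_def)
  qed
  have Q0: "Q i = 0" if "i > Suc k" for i
    using that top[of i] top[of "i - 1"] by (cases i) (auto simp: Q_def)
  have Q1: "Q (Suc k) = pd (Uj k) P"
    by (simp add: Q_def top)
  have P': "pd U (pd c P) = 0" "pd c (pd U P) = 0" for c
    using P(1) by (simp_all add: pd_commute[of U])
  have lev: "level N (pd c P)" for c by (rule level_pd[OF P(3)])
  \<comment> \<open>With zero right-hand side \<open>kernel_lemma\<close> removes all u_i, and what
    is left of the equation is the vanishing of the derivative in conj z.\<close>
  have hol: "pd c (pd (Uj m) P) = 0" if Db0: "Db N (pd (Uj m) P) = 0" and c: "c \<noteq> Z" for m c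
  proof -
    have U: "pd (Uj i) (pd (Uj m) P) = 0" for i
      by (rule kernel_lemma(2)[where s = 0 and q = 0]) (use Db0 k P' P(2) lev in auto)
    then have "pd Zbar (pd (Uj m) P) = 0"
      using Db0 by (simp add: Db_eq P' P(2))
    then show ?thesis using U c P(2) P' by (cases c) auto
  qed
  have DbD: "Db N (D N F) = 0" if F: "\<And>c. c \<noteq> Z \<Longrightarrow> pd c F = 0" for F
  proof -
    have "D N F = pd Z F" using F by (simp add: D_eq)
    moreover have "pd c (pd Z F) = 0" if "c \<noteq> Z" for c using F[OF that] by (simp add: pd_commute[of c])
    ultimately show ?thesis by (simp add: Db_eq)
  qed
  \<comment> \<open>T^i involves only u_j with j < i, whereas \<open>Q i\<close> vanishes for i > k
    + 1, so no product survives.\<close>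
  have "(\<Sum>i<N. pd (Uj (Suc k)) (Ts i) * Q i) = 0"
  proof (intro sum.neutral ballI)
    fix i show "pd (Uj (Suc k)) (Ts i) * Q i = 0"
      using Q0[of i] by (cases "i \<le> Suc k") simp_all
  qed
  then have "Db N (pd (Uj k) P) = 0"
    using dE[of "Suc k"] k by (simp add: Q1 top)
  then have hk: "pd c (pd (Uj k) P) = 0" if "c \<noteq> Z" for c
    using hol that by blast
  then show "c \<noteq> Z \<Longrightarrow> pd c (pd (Uj k) P) = 0" .
  assume "0 < k"
  then obtain m where m: "k = Suc m" by (cases k) auto
  have "(\<Sum>i<N. pd (Uj k) (Ts i) * Q i) = (\<Sum>i\<in>{Suc k}. pd (Uj k) (Ts i) * Q i)"
  proof (rule sum.mono_neutral_right)
    show "\<forall>i\<in>{..<N} - {Suc k}. pd (Uj k) (Ts i) * Q i = 0"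
    proof
      fix i assume "i \<in> {..<N} - {Suc k}"
      then have "i \<le> k \<or> i > Suc k" by auto
      then show "pd (Uj k) (Ts i) * Q i = 0" using Q0[of i] by auto
    qed
  qed (use k in auto)
  then have "Db N (Q k) = 0"
    using dE[of k] k by (simp add: Q1)
  then have "Db N (pd (Uj m) P) = 0"
    using DbD[OF hk] by (simp add: Q_def m)
  then have hm: "pd c (pd (Uj m) P) = 0" if "c \<noteq> Z" for c
    using hol that by blast
  have Dk: "D N (pd (Uj k) P) = pd Z (pd (Uj k) P)"
    using hk by (simp add: D_eq)
  have "(\<Sum>i<N. pd (Uj m) (Ts i) * Q i) = (\<Sum>i\<in>{k, Suc k}. pd (Uj m) (Ts i) * Q i)"
  proof (rule sum.mono_neutral_right)
    show "\<forall>i\<in>{..<N} - {k, Suc k}. pd (Uj m) (Ts i) * Q i = 0"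
    proof
      fix i assume "i \<in> {..<N} - {k, Suc k}"
      then have "i \<le> m \<or> i > Suc k" using m by auto
      then show "pd (Uj m) (Ts i) * Q i = 0" using Q0[of i] by auto
    qed
  qed (use k in auto)
  also have "\<dots> = fu 1 * (pd Z (pd (Uj k) P) + pd (Uj m) P) + of_nat (m + 2) * uj 0 * fu 2 * pd (Uj k) P"
    using Q1 by (simp add: m Q_def Dk[unfolded m])
  \<comment> \<open>The summand f' P_{u_m} cancels against the one coming from f' P. The factor m +
    2 is the coefficient of u_0 f'' in the u_m-derivative of T^{m+2}.\<close>
  finally have "Db N (Q m) = fu 1 * pd Z (pd (Uj k) P) + uj 0 * fu 2 * (of_nat (Suc (Suc m)) * pd (Uj k) P)"
    using dE[of m] k m by (simp add: algebra_simps)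
  then have R: "Db N (pd (prev m) P) = fu 1 * pd Z (pd (Uj k) P) + uj 0 * fu 2 * (of_nat (Suc (Suc m)) * pd (Uj k) P)"
    using DbD[OF hm] by (simp add: Q_def)
  have "of_nat (Suc (Suc m)) * pd (Uj k) P = 0"
  proof (rule kernel_lemma(1)[OF _ _ _ _ R])
    show "pd (Ujbar j) (pd (prev m) P) = 0" for j
      using P(2) P'(2) by (cases m) auto
    show "pd c (pd Z (pd (Uj k) P)) = 0" if "c \<noteq> Z" for c
      using hk[OF that] by (simp add: pd_commute[of c])
    show "pd c (of_nat (Suc (Suc m)) * pd (Uj k) P) = 0" if "c \<noteq> Z" for c
      using hk[OF that] by (simp del: of_nat_Suc)
  qed (use k P' lev in auto)
  then show "pd (Uj k) P = 0" unfolding of_nat_mult_eq_0_sfun .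
qed

lemma coefficients:
  assumes P: "pd U P = 0" "\<And>i j. pd (Ujbar j) (pd (Uj i) P) = 0" "level K P" "K + 2 \<le> N"
    and E: "Db N (D N P) + fu 1 * P = 0"
  shows "0 < i \<Longrightarrow> pd (Uj i) P = 0" "c \<noteq> Z \<Longrightarrow> pd c (pd (Uj 0) P) = 0"
proof -
  have lev: "level N P" using level_mono[OF P(3)] P(4) by simp
  have *: "pd (Uj i) P = 0" if "0 < i" for i
    using that
  proof (induction "K - i" arbitrary: i rule: less_induct)
    case less
    show ?case
    proof (cases "i < K")
      case True
      have "pd (Uj j) P = 0" if "j > i" for j
      proof (cases "j < K")
        case True
        then show ?thesis using less that by auto
      qed (use levelD(1)[OF P(3)] in auto)
      then show ?thesis
        by (rule top_coefficient(2)[OF P(1,2) lev E]) (use True P(4) less.prems in auto)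
    qed (use levelD(1)[OF P(3)] in auto)
  qed
  then show "0 < i \<Longrightarrow> pd (Uj i) P = 0" .
  show "c \<noteq> Z \<Longrightarrow> pd c (pd (Uj 0) P) = 0"
    by (rule top_coefficient(1)[OF P(1,2) lev E]) (use * P(4) in auto)
qed

text \<open>Applying \<open>coefficients\<close> to P and to its conjugate leaves only u_0 and conj
  u_0. Since q and r do not involve u, the remaining equation has the form P_{z conj z} - f b + f' h
  = 0 with h and b free of u, and its u-derivative separates them.\<close>

lemma linearized_solutions:
  assumes P: "pd U P = 0" "\<And>i j. pd (Ujbar j) (pd (Uj i) P) = 0" "level K P" "K + 2 \<le> N"
    and E: "Db N (D N P) + fu 1 * P = 0"
  defines "q \<equiv> pd (Uj 0) P" and "r \<equiv> pd (Ujbar 0) P"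
  shows "0 < i \<Longrightarrow> pd (Uj i) P = 0" "0 < i \<Longrightarrow> pd (Ujbar i) P = 0"
    "c \<noteq> Z \<Longrightarrow> pd c q = 0" "c \<noteq> Zbar \<Longrightarrow> pd c r = 0"
    "P = uj 0 * q + cj (uj 0) * r" "pd Z q + pd Zbar r = 0"
proof -
  note C = coefficients[OF P E]
  then show 1: "pd (Uj i) P = 0" if "0 < i" for i using that by blast
  have q: "pd c q = 0" if "c \<noteq> Z" for c using C that unfolding q_def by blast
  then show "c \<noteq> Z \<Longrightarrow> pd c q = 0" .
  \<comment> \<open>Conjugation exchanges \<open>D N\<close> and \<open>Db N\<close>, which commute
    on functions of this level.\<close>
  have "Db N (D N (cj P)) + fu 1 * cj P = 0"
  proof -
    have "cj (Db N (D N P) + fu 1 * P) = 0" using E by simp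
    then show ?thesis
      using D_Db_commute[OF P(3), of N] P(4) by (simp add: D_cj Db_cj)
  qed
  moreover have "pd (Ujbar j) (pd (Uj i) (cj P)) = 0" for i j
    using P(2)[of i j] P(2)[of j i] by (simp add: pd_cj pd_commute[of "Uj j"])
  ultimately have C': "0 < i \<Longrightarrow> pd (Uj i) (cj P) = 0" "c \<noteq> Z \<Longrightarrow> pd c (pd (Uj 0) (cj P)) = 0" for i c
    using coefficients[of "cj P" K N] P(1,4) level_cj[OF P(3)] by (auto simp: pd_cj)
  show 2: "pd (Ujbar i) P = 0" if "0 < i" for i
    using C'(1)[OF that] by (simp add: pd_cj)
  have r: "pd c r = 0" if "c \<noteq> Zbar" for c
    using C'(2)[of "conj_coord c"] that by (auto simp: pd_cj r_def)
  then show "c \<noteq> Zbar \<Longrightarrow> pd c r = 0" .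
  have N: "0 < N" "1 < N" using P(4) by simp_all
  have sums: "(\<Sum>i<N. g i * pd (Uj i) F) = g 0 * pd (Uj 0) F"
    if "\<And>i. 0 < i \<Longrightarrow> pd (Uj i) F = 0" for F and g :: "nat \<Rightarrow> sfun"
  proof -
    have "(\<Sum>i<N. g i * pd (Uj i) F) = (\<Sum>i\<in>{0}. g i * pd (Uj i) F)"
      by (rule sum.mono_neutral_right) (use that N in auto)
    then show ?thesis by simp
  qed
  have sums': "(\<Sum>i<N. g i * pd (Ujbar i) F) = g 0 * pd (Ujbar 0) F"
    if "\<And>i. 0 < i \<Longrightarrow> pd (Ujbar i) F = 0" for F and g :: "nat \<Rightarrow> sfun"
  proof -
    have "(\<Sum>i<N. g i * pd (Ujbar i) F) = (\<Sum>i\<in>{0}. g i * pd (Ujbar i) F)"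
      by (rule sum.mono_neutral_right) (use that N in auto)
    then show ?thesis by simp
  qed
  have DP: "D N P = pd Z P + uj 1 * q - fu 0 * r"
    unfolding D_eq using sums[OF 1, of "\<lambda>i. uj (Suc i)"] sums'[OF 2, of "\<lambda>i. cj (Ts i)"]
    by (simp add: P(1) q_def r_def)
  have Zc: "pd c (pd Z P) = pd Z (pd c P)" for c by (rule pd_commute)
  have PZ: "Db N (pd Z P) = pd Zbar (pd Z P) - fu 0 * pd Z q"
    unfolding Db_eq using sums[of "pd Z P" Ts] sums'[of "pd Z P" "\<lambda>i. cj (uj (Suc i))"] r[of Z]
    by (simp add: Zc 1 2 P(1) q_def r_def)
  have Db_qr: "Db N q = 0" "Db N r = pd Zbar r"
    using q r by (simp_all add: Db_eq)
  have eq: "pd Zbar (pd Z P) - fu 0 * (pd Z q + pd Zbar r) - fu 1 * (uj 0 * q + cj (uj 0) * r) + fu 1 * P = 0"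
    using E unfolding DP using Db_uj[OF N(2)] by (simp add: PZ Db_qr Db_fu Ts_1 algebra_simps)
  \<comment> \<open>\<open>h\<close> measures the failure of P to be linear in u_0 and conj
    u_0.\<close>
  define h where "h = P - (uj 0 * q + cj (uj 0) * r)"
  define b where "b = pd Z q + pd Zbar r"
  have Uh: "pd U h = 0" and Ub: "pd U b = 0"
    using q[of U] r[of U] P(1) by (simp_all add: h_def b_def pd_cj pd_commute[of U])
  have "pd Zbar (pd Z P) - fu 0 * b + fu 1 * h = 0"
    using eq by (simp add: h_def b_def algebra_simps)
  then have "pd U (pd Zbar (pd Z P) - fu 0 * b + fu 1 * h) = 0" by simp
  then have hb: "fu 2 * h - fu 1 * b = 0"
    using P(1) Uh Ub by (simp add: pd_commute[of U] numeral_2_eq_2)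
  have "fn h (z, u, w) = 0 \<and> fn b (z, u, w) = 0" for z u w
  proof -
    let ?h = "fn h (z, u, w)" and ?b = "fn b (z, u, w)"
    have *: "deriv (deriv f) v * ?h - deriv f v * ?b = 0" for v
    proof -
      have "fn (fu 2 * h - fu 1 * b) (z, v, w) = 0" unfolding hb by simp
      then show ?thesis
        by (simp add: fn_fu u_of_def numeral_2_eq_2 pd_U_0_indep[OF Uh, of z v w u] pd_U_0_indep[OF Ub, of z v w u])
    qed
    have "0 * f v + (- Re ?b) * deriv f v + Re ?h * deriv (deriv f) v = 0"
      "0 * f v + (- Im ?b) * deriv f v + Im ?h * deriv (deriv f) v = 0" for v
      using arg_cong[OF *[of v], of Re] arg_cong[OF *[of v], of Im] by (simp_all add: algebra_simps)
    then have "Re ?b = 0 \<and> Re ?h = 0" "Im ?b = 0 \<and> Im ?h = 0"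
      using independent[of 0 "- Re ?b" "Re ?h"] independent[of 0 "- Im ?b" "Im ?h"] by simp_all
    then show ?thesis by (simp add: complex_eq_iff)
  qed
  then have "h = 0" "b = 0" by (auto simp: sfun_eq_iff)
  then show "P = uj 0 * q + cj (uj 0) * r" "pd Z q + pd Zbar r = 0"
    by (simp_all add: h_def b_def)
qed

end

lemma two_mult_eq_0_sfun [simp]: "2 * F = (0 :: sfun) \<longleftrightarrow> F = 0"
  using of_nat_mult_eq_0_sfun[of 1 F] by simp

lemma add_self_eq_0_sfun [simp]: "F + F = (0 :: sfun) \<longleftrightarrow> F = 0"
  by (metis mult_2 two_mult_eq_0_sfun)

lemma conj_coord_coords: "conj_coord ` coords N = coords N"
proof -
  have "conj_coord c \<in> coords N" if "c \<in> coords N" for c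
    using that by (cases c) (auto simp: coords_def)
  then show ?thesis by (metis conj_coord_simps(1) image_subset_iff subset_antisym subsetI image_eqI)
qed

lemma sum_coords_conj: "(\<Sum>c\<in>coords N. g (conj_coord c)) = sum g (coords N)"
  by (rule sum.reindex_cong[symmetric, of conj_coord])
     (auto simp: conj_coord_coords intro: inj_on_inverseI[of _ conj_coord])

section \<open>Closed 2-forms in normal form\<close>

context poisson
begin

text \<open>Commutation of the two total derivatives, coefficient by coefficient; at the excluded
  top index the truncation has dropped u_N.\<close>

lemma Dv_commute:
  assumes "c \<in> coords N" "0 < N" "c \<noteq> Uj (N - 1)" "c \<noteq> Ujbar (N - 1)"
  shows "D N (Dbv c) = Db N (Dv c)"
proof (cases c)
  case (Uj i)
  then have "Suc i < N" using assms by (auto simp: coords_def)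
  then show ?thesis by (simp add: Uj D_Ts Db_uj)
next
  case (Ujbar i)
  then have "Suc i < N" using assms by (auto simp: coords_def)
  then show ?thesis by (simp add: Ujbar D_cj Db_cj D_Ts Db_uj)
qed (use assms in \<open>simp_all add: D_cj Db_uj\<close>)

text \<open>Components \<open>G\<close> of a closed real 2-form, with its contractions
  \<open>iD\<close> and \<open>jD\<close> with e_{-1} and its conjugate. The assumptions on
  \<open>iD\<close> record what the normal form says after contraction; \<open>a\<close> stands for
  A / (2i), hence is imaginary.\<close>

context
  fixes G :: "coord \<Rightarrow> coord \<Rightarrow> sfun" and a :: sfun and K N :: nat and iD jD
  assumes anti: "\<And>x y. G x y = - G y x"
    and closed: "\<And>x y z. pd x (G y z) - pd y (G x z) + pd z (G x y) = 0"
    and real: "\<And>x y. cj (G x y) = G (conj_coord x) (conj_coord y)"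
    and vanish: "\<And>j y. K \<le> j \<Longrightarrow> G (Uj j) y = 0"
    and lev: "level K a" and N: "K + 3 \<le> N" and imag: "cj a = - a"
  defines "iD \<equiv> \<lambda>y. \<Sum>c\<in>coords N. Dv c * G c y"
    and "jD \<equiv> \<lambda>y. \<Sum>c\<in>coords N. Dbv c * G c y"
  assumes iD_Uj: "\<And>j. iD (Uj j) = (if j = 0 then a else 0)"
    and iD_Ujbar: "\<And>j. iD (Ujbar j) = 0"
    and iD_Db: "(\<Sum>y\<in>coords N. Dbv y * iD y) = 0"
begin

text \<open>The 2-form evaluated on the commutator of d/dx with e_{-1} and on d/dy: the correction
  terms of the Lie derivative.\<close>

definition W :: "coord \<Rightarrow> coord \<Rightarrow> sfun" where
  "W x y = (\<Sum>c\<in>coords N. pd x (Dv c) * G c y)"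

lemma G_diag [simp]: "G x x = 0"
  using anti[of x x] by (metis add.right_inverse add_self_eq_0_sfun)

lemma vanish_bar: "K \<le> j \<Longrightarrow> G (Ujbar j) y = 0"
  using real[of "Uj j" "conj_coord y"] vanish[of j "conj_coord y"] by simp

lemma cj_iD: "jD y = cj (iD (conj_coord y))"
proof -
  have "cj (iD (conj_coord y)) = (\<Sum>c\<in>coords N. Dbv (conj_coord c) * G (conj_coord c) y)"
    by (simp add: iD_def cj_sum real Dbv_def)
  then show ?thesis by (simp add: jD_def sum_coords_conj[of "\<lambda>c. Dbv c * G c y"])
qed

lemma W_U: "W U y = - (\<Sum>i<N. cj (pd U (Ts i)) * G (Ujbar i) y)"
  by (simp add: W_def sum_coords pd_cj sum_negf)

lemma W_Uj: "j \<le> N \<Longrightarrow> W (Uj j) y = G (prev j) y"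
  by (cases j) (auto simp: W_def sum_coords pd_cj mult_delta_left)

lemma W_Ujbar: "W (Ujbar j) y = - (\<Sum>i<N. cj (pd (Uj j) (Ts i)) * G (Ujbar i) y)"
  by (simp add: W_def sum_coords pd_cj sum_negf)

text \<open>Cartan's formula L_D Phi = d(i_D Phi) for closed Phi, evaluated on coordinate
  fields.\<close>

lemma D_G: "D N (G x y) = pd x (iD y) - pd y (iD x) - W x y + W y x"
proof -
  have "(\<Sum>c\<in>coords N. Dv c * (pd c (G x y) - pd x (G c y) + pd y (G c x))) = 0"
    by (simp add: closed)
  moreover have "(\<Sum>c\<in>coords N. Dv c * (pd c (G x y) - pd x (G c y) + pd y (G c x))) =
      D N (G x y) - (pd x (iD y) - W x y) + (pd y (iD x) - W y x)"
    by (simp add: vf_def iD_def W_def algebra_simps sum.distrib sum_subtractf)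
  ultimately show ?thesis by (simp add: algebra_simps)
qed

text \<open>Contract \<open>D_G\<close> with the conjugate field. As the two fields commute, the
  terms in \<open>D N (Dbv c)\<close> cancel against those in \<open>W y b\<close>; at the top
  index, where truncated commutation fails, \<open>G\<close> vanishes. \<open>iD_Db\<close>,
  differentiated along b, moves the derivative from \<open>iD\<close> to \<open>Dbv\<close>.\<close>

lemma D_jD:
  "D N (jD b) = Db N (iD b) + (\<Sum>y\<in>coords N. pd b (Dbv y) * iD y) - (\<Sum>y\<in>coords N. pd b (Dv y) * jD y)"
proof -
  let ?C = "coords N"
  have 0: "D N (Dbv c) * G c b = Db N (Dv c) * G c b" if "c \<in> ?C" for c
  proof (cases "c = Uj (N - 1) \<or> c = Ujbar (N - 1)")
    case True
    then have "G c b = 0" using vanish[of "N - 1"] vanish_bar[of "N - 1"] N by auto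
    then show ?thesis by simp
  next
    case False
    then show ?thesis using Dv_commute[OF that] N by simp
  qed
  have "D N (jD b) = (\<Sum>y\<in>?C. Dbv y * D N (G y b)) + (\<Sum>y\<in>?C. D N (Dbv y) * G y b)"
    by (simp add: jD_def vf_sum sum.distrib add.commute)
  also have "(\<Sum>y\<in>?C. D N (Dbv y) * G y b) = (\<Sum>y\<in>?C. Db N (Dv y) * G y b)"
    by (rule sum.cong) (simp_all add: 0)
  also have "(\<Sum>y\<in>?C. Dbv y * D N (G y b)) =
      Db N (iD b) - (\<Sum>y\<in>?C. Dbv y * pd b (iD y)) - (\<Sum>y\<in>?C. Dbv y * W y b) + (\<Sum>y\<in>?C. Dbv y * W b y)"
    unfolding D_G vf_def[of _ _ Dbv] by (simp add: algebra_simps sum.distrib sum_subtractf)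
  also have "(\<Sum>y\<in>?C. Dbv y * pd b (iD y)) = - (\<Sum>y\<in>?C. pd b (Dbv y) * iD y)"
  proof -
    have "pd b (\<Sum>y\<in>?C. Dbv y * iD y) = 0" unfolding iD_Db by simp
    then show ?thesis by (simp add: sum.distrib add_eq_0_iff)
  qed
  also have "(\<Sum>y\<in>?C. Dbv y * W y b) = (\<Sum>c\<in>?C. Db N (Dv c) * G c b)"
    unfolding W_def vf_def[of _ _ Dbv]
    by (simp add: sum_distrib_left sum_distrib_right mult.assoc) (rule sum.swap)
  also have "(\<Sum>y\<in>?C. Dbv y * W b y) = - (\<Sum>c\<in>?C. pd b (Dv c) * jD c)"
  proof -
    have "(\<Sum>y\<in>?C. Dbv y * W b y) = (\<Sum>c\<in>?C. \<Sum>y\<in>?C. pd b (Dv c) * (Dbv y * G c y))"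
      unfolding W_def sum_distrib_left by (subst sum.swap) (simp add: mult.left_commute)
    also have "\<dots> = (\<Sum>c\<in>?C. \<Sum>y\<in>?C. - (pd b (Dv c) * (Dbv y * G y c)))"
      by (intro sum.cong refl) (subst anti, simp)
    finally show ?thesis unfolding jD_def by (simp add: sum_negf sum_distrib_left)
  qed
  finally show ?thesis by (simp add: algebra_simps)
qed

text \<open>If row i + 1 vanishes, \<open>D_G\<close> at that row reduces to
  \<open>G (Uj i) (Ujbar j) = 0\<close>, because commutation with e_{-1} lowers u_{i+1} to u_i. The
  descent starts at K.\<close>

lemma G_Uj_Ujbar: "G (Uj i) (Ujbar j) = 0"
proof (induction "K - i" arbitrary: i j rule: less_induct)
  case less
  show ?case
  proof (cases "i < K")
    case True
    have *: "G (Uj (Suc i)) (Ujbar m) = 0" for m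
      using less True by (cases "Suc i < K") (simp_all add: vanish)
    have **: "G (Ujbar m) (Uj (Suc i)) = 0" for m
      using anti[of "Ujbar m"] * by simp
    show ?thesis
      using D_G[of "Uj (Suc i)" "Ujbar j"] True N
      by (simp add: * ** W_Uj W_Ujbar iD_Uj iD_Ujbar)
  qed (simp add: vanish)
qed

lemma G_Ujbar_Uj: "G (Ujbar j) (Uj i) = 0"
  using anti[of "Ujbar j"] G_Uj_Ujbar by simp

text \<open>One more step of the same descent, from u_0 to u; here \<open>iD (Uj 0) = a\<close>
  contributes a derivative.\<close>

lemma G_U_Ujbar: "G U (Ujbar j) = - pd (Ujbar j) a"
  using D_G[of "Uj 0" "Ujbar j"]
  by (simp add: G_Uj_Ujbar G_Ujbar_Uj W_Uj W_Ujbar iD_Uj iD_Ujbar algebra_simps add_eq_0_iff2)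

lemma G_U_Uj: "G U (Uj j) = pd (Uj j) a"
proof -
  have "cj (pd (Ujbar j) a) = - pd (Uj j) a"
    using pd_cj[of "Uj j" a] by (simp add: imag)
  then have "cj (G U (Ujbar j)) = pd (Uj j) a"
    by (simp add: G_U_Ujbar)
  then show ?thesis by (simp add: real)
qed

text \<open>Closedness in the directions u, u_i, conj u_j produces the mixed derivative of
  \<open>a\<close> twice with the same sign.\<close>

lemma a_mixed: "pd (Ujbar j) (pd (Uj i) a) = 0"
  using closed[of U "Uj i" "Ujbar j"]
  by (simp add: G_Uj_Ujbar G_U_Ujbar G_U_Uj pd_commute[of "Uj i"])

lemma jD_simps: "jD (Uj j) = 0" "jD (Ujbar j) = (if j = 0 then - a else 0)" "jD U = Db N a"
proof -
  show 1: "jD (Uj j) = 0" for j by (simp add: cj_iD iD_Ujbar)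
  show "jD (Ujbar j) = (if j = 0 then - a else 0)" by (simp add: cj_iD iD_Uj imag)
  have "(\<Sum>y\<in>coords N. pd (Uj 0) (Dbv y) * iD y) = 0"
    by (simp add: sum_coords pd_cj iD_Uj iD_Ujbar mult_delta_right)
  moreover have "(\<Sum>y\<in>coords N. pd (Uj 0) (Dv y) * jD y) = jD U"
    by (simp add: sum_coords pd_cj)
  ultimately show "jD U = Db N a"
    using D_jD[of "Uj 0"] by (simp add: 1 iD_Uj)
qed

lemma iD_U: "iD U = - D N a"
proof -
  have "cj (jD U) = - D N a"
    unfolding jD_simps by (simp add: D_cj[symmetric] imag)
  then show ?thesis using cj_iD[of U] by simp
qed

text \<open>\<open>D_jD\<close> along u gives D(Db a) = -Db(D a) - 2 f' a; by commutation this is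
  twice the linearized equation.\<close>

lemma a_linearized: "Db N (D N a) + fu 1 * a = 0"
proof -
  have 1: "(\<Sum>y\<in>coords N. pd U (Dbv y) * iD y) = - (fu 1 * a)"
    using N by (simp add: sum_coords pd_cj iD_Uj iD_Ujbar mult_delta_right)
  have 2: "(\<Sum>y\<in>coords N. pd U (Dv y) * jD y) = fu 1 * a"
    using N by (simp add: sum_coords pd_cj jD_simps mult_delta_right)
  have "D N (Db N a) = - Db N (D N a) - fu 1 * a - fu 1 * a"
    using D_jD[of U] unfolding 1 2 by (simp add: jD_simps iD_U)
  then have "(Db N (D N a) + fu 1 * a) + (Db N (D N a) + fu 1 * a) = 0"
    using D_Db_commute[OF lev, of N] N by (simp add: algebra_simps)
  then show ?thesis by (simp only: add_self_eq_0_sfun)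
qed

text \<open>\<open>D_G\<close> along u and u_0 contributes one a_u, and the commutator of d/du_0
  with e_{-1} a second one.\<close>

lemma a_U: "pd U a = 0"
proof -
  have "D N (G U (Uj 0)) = pd U a + pd (Uj 0) (D N a)"
    using D_G[of U "Uj 0"] by (simp add: iD_Uj iD_U W_U W_Uj G_Ujbar_Uj)
  then show ?thesis
    by (simp add: G_U_Uj pd_Uj_D)
qed

lemma a_Uj: "0 < i \<Longrightarrow> pd (Uj i) a = 0"
  by (rule linearized_solutions(1)[OF a_U a_mixed lev _ a_linearized]) (use N in simp_all)

text \<open>The descent again, but for j = 0 it picks up derivatives of \<open>a\<close> along
  u_{i+1}; these vanish because \<open>a\<close> solves the linearized equation.\<close>

lemma G_Uj_Uj: "G (Uj i) (Uj j) = 0"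
proof (induction "K - i" arbitrary: i j rule: less_induct)
  case less
  show ?case
  proof (cases "i < K")
    case True
    have *: "G (Uj (Suc i)) (Uj m) = 0" for m
      using less True by (cases "Suc i < K") (simp_all add: vanish)
    have **: "G (prev j) (Uj (Suc i)) = 0"
    proof (cases j)
      case (Suc m)
      then show ?thesis using anti[of "Uj m"] * by simp
    qed (simp add: G_U_Uj a_Uj)
    show ?thesis
    proof (cases "j \<le> N")
      case True
      then show ?thesis
        using D_G[of "Uj (Suc i)" "Uj j"] \<open>i < K\<close> N
        by (cases "j = 0") (simp_all add: * ** W_Uj iD_Uj a_Uj G_U_Uj)
    next
      case False
      then show ?thesis using anti[of "Uj i" "Uj j"] N by (simp add: vanish)
    qed
  qed (simp add: vanish)
qed

text \<open>Only the dz and d(conj z) components remain, and the two contractions determine them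
  from components already known to be zero.\<close>

lemma G_higher_vanish: "G (Uj (Suc j)) y = 0"
proof -
  have U: "G U (Uj (Suc j)) = 0" by (simp add: G_U_Uj a_Uj)
  have Z: "G Z (Uj (Suc j)) = 0"
    using iD_Uj[of "Suc j"] by (simp add: iD_def sum_coords U G_Uj_Uj G_Ujbar_Uj)
  have Zb: "G Zbar (Uj (Suc j)) = 0"
    using jD_simps(1)[of "Suc j"] by (simp add: jD_def sum_coords U G_Uj_Uj G_Ujbar_Uj)
  have "G y (Uj (Suc j)) = 0"
    by (cases y) (simp_all add: U Z Zb G_Uj_Uj G_Ujbar_Uj)
  then show ?thesis using anti[of "Uj (Suc j)"] by simp
qed

end

end

section \<open>The spaces $V_d$\<close>

text \<open>The smoothness bound leaves finitely many coordinates above m; they are changed one at a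
  time, from the top down.\<close>

lemma partial_Uj_0_depends:
  assumes F: "smooth_fun F"
    and "\<And>j p. m \<le> j \<Longrightarrow> partial (Uj j) F p = 0" "\<And>j p. m \<le> j \<Longrightarrow> partial (Ujbar j) F p = 0"
    and "\<And>j. j < m \<Longrightarrow> v j = w j"
  shows "F (z, u, v) = F (z, u, w)"
proof -
  obtain k where k: "depends_upto k F" using F smooth_fun_onD(1) unfolding smooth_fun_def by blast
  have "\<forall>v w. (\<forall>j<m. v j = w j) \<longrightarrow> F (z, u, v) = F (z, u, w)"
  proof (rule inc_induct[of m "max m (Suc k)"])
    show "\<forall>v w. (\<forall>j<max m (Suc k). v j = w j) \<longrightarrow> F (z, u, v) = F (z, u, w)"
      using k unfolding depends_upto_def by (simp add: less_max_iff_disj less_Suc_eq_le)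
    fix n assume n: "m \<le> n" and IH: "\<forall>v w. (\<forall>j<Suc n. v j = w j) \<longrightarrow> F (z, u, v) = F (z, u, w)"
    show "\<forall>v w. (\<forall>j<n. v j = w j) \<longrightarrow> F (z, u, v) = F (z, u, w)"
    proof (intro allI impI)
      fix v w :: "nat \<Rightarrow> complex" assume vw: "\<forall>j<n. v j = w j"
      have "F (z, u, v) = F (z, u, v(n := w n))"
        using partial_Uj_0_constant[OF F] assms(2,3) n by metis
      also have "\<dots> = F (z, u, w)"
        using vw by (intro IH[rule_format]) (auto simp: less_Suc_eq)
      finally show "F (z, u, v) = F (z, u, w)" .
    qed
  qed simp
  then show ?thesis using assms(4) by blast
qed

lemma pd_all_0_const:
  assumes "\<And>c. pd c F = 0" obtains a where "F = const a"
proof -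
  have 0: "partial c (fn F) p = 0" for c p
    using arg_cong[OF assms[of c], of "\<lambda>F. fn F p"] by simp
  have "fn F (z, u, w) = fn F (0, 0, \<lambda>_. 0)" for z u w
  proof -
    have "fn F (z, u, w) = fn F (0, u, w)" by (rule partial_Z_0_constant) (simp_all only: 0 smooth_fun_fn)
    also have "\<dots> = fn F (0, 0, w)" by (rule partial_U_0_constant) (simp_all only: 0 smooth_fun_fn)
    also have "\<dots> = fn F (0, 0, \<lambda>_. 0)"
      by (rule partial_Uj_0_depends[of _ 0]) (simp_all only: 0 smooth_fun_fn not_less0)
    finally show ?thesis .
  qed
  then have "F = const (fn F (0, 0, \<lambda>_. 0))" by (auto simp: sfun_eq_iff)
  then show ?thesis using that by blast
qed

text \<open>A rotation by pi / m turns a term whose weight differs from d by m into its negative,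
  which forces the term to vanish.\<close>

lemma ex_unit_powi_minus_1:
  assumes "m \<noteq> (0 :: int)" shows "\<exists>l. norm l = 1 \<and> l powi m = (- 1 :: complex)"
proof (intro exI conjI)
  show "norm (cis (pi / real_of_int m)) = 1" by simp
  show "cis (pi / real_of_int m) powi m = - 1"
    using assms by (simp add: cis_power_int)
qed

context poisson
begin

lemma e_minus1_fn:
  assumes "level N F" shows "e_minus1 f (fn F) = fn (D N F)"
proof
  fix p
  have z: "partial (Uj i) (fn F) p = 0" "partial (Ujbar i) (fn F) p = 0" if "i \<notin> {..<N}" for i
    using levelD[OF assms, of i] that fn_simps(1,9) by (metis lessThan_iff not_less)+
  have "(\<Sum>i. uj_of (Suc i) p * partial (Uj i) (fn F) p) = (\<Sum>i<N. uj_of (Suc i) p * partial (Uj i) (fn F) p)"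
    by (rule suminf_finite) (simp_all add: z del: partial.simps)
  moreover have "(\<Sum>i. cnj (T f i p) * partial (Ujbar i) (fn F) p) = (\<Sum>i<N. cnj (T f i p) * partial (Ujbar i) (fn F) p)"
    by (rule suminf_finite) (simp_all add: z del: partial.simps)
  ultimately show "e_minus1 f (fn F) p = fn (D N F) p"
    by (simp add: e_minus1_def D_eq fn_Ts del: partial.simps)
qed

lemma e_minus1_bar_fn:
  assumes "level N F" shows "e_minus1_bar f (fn F) = fn (Db N F)"
proof
  fix p
  have "(\<lambda>q. cnj (fn F q)) = fn (cj F)" by auto
  then show "e_minus1_bar f (fn F) p = fn (Db N F) p"
    using e_minus1_fn[OF level_cj[OF assms]] by (simp add: e_minus1_bar_def D_cj)
qed

lemma level_D:
  assumes "level K F" shows "level (Suc K) (D N F)"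
proof -
  have "D N F = D (min N K) F"
  proof (cases "K \<le> N")
    case True
    have "fn (D N F) = fn (D K F)"
      by (rule trans[OF sym[OF e_minus1_fn[OF level_mono[OF assms True]]] e_minus1_fn[OF assms]])
    then show ?thesis using True by (simp add: fn_inject)
  qed simp
  moreover have "pd (Uj j) (D (min N K) F) = 0 \<and> pd (Ujbar j) (D (min N K) F) = 0" if "Suc K \<le> j" for j
    using levelD[OF level_pd[OF assms], of j] levelD[OF assms, of j] that
    by (simp add: D_eq pd_cj)
  ultimately show ?thesis by (simp add: level_def)
qed

text \<open>q is holomorphic in z, r is antiholomorphic, and q_z is minus the derivative of r in
  conj z. That common value is both, hence a constant \<gamma>, so q and r are affine.\<close>

lemma V_solution:
  assumes "P \<in> V f d"
  obtains \<alpha> \<beta> \<gamma> where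
    "\<And>z u w. P (z, u, w) = w 0 * (\<alpha> + \<gamma> * z) + cnj (w 0) * (\<beta> - \<gamma> * cnj z)"
proof -
  define F where "F = Sfun P"
  have "smooth_fun P" using assms by (simp add: V_def)
  then have P: "fn F = P" by (simp add: F_def Sfun_inverse)
  obtain K where K: "level K F" by (rule ex_level)
  define N where "N = K + 2"
  have "e_minus1_bar f (e_minus1 f P) = fn (Db N (D N F))"
    unfolding P[symmetric] using e_minus1_fn[OF level_mono[OF K], of N]
      e_minus1_bar_fn[OF level_mono[OF level_D[OF K]], of N N] by (simp add: N_def)
  then have E: "Db N (D N F) + fu 1 * F = 0"
    using assms by (simp add: V_def sfun_eq_iff fn_fu P)
  have U: "pd U F = 0" and mixed: "pd (Ujbar j) (pd (Uj i) F) = 0" for i j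
  proof -
    show "pd U F = 0" using assms by (simp add: V_def sfun_eq_iff P)
    have "fn (pd (Uj i) F) = partial (Uj i) P" by (rule ext) (simp only: fn_simps P)
    then have "fn (pd (Ujbar j) (pd (Uj i) F)) p = 0" for p
      using assms by (simp add: V_def del: partial.simps split_paired_All)
    then show "pd (Ujbar j) (pd (Uj i) F) = 0" unfolding sfun_eq_iff fn_simps(1) by blast
  qed
  define q r where "q = pd (Uj 0) F" and "r = pd (Ujbar 0) F"
  note sol = linearized_solutions[OF U mixed K _ E, folded q_def r_def]
  have q: "pd c q = 0" if "c \<noteq> Z" for c using sol(3)[OF _ that] by (simp add: N_def)
  have r: "pd c r = 0" if "c \<noteq> Zbar" for c using sol(4)[OF _ that] by (simp add: N_def)
  have F: "F = uj 0 * q + cj (uj 0) * r" and qr: "pd Zbar r = - pd Z q"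
    using sol(5,6) by (simp_all add: N_def add_eq_0_iff)
  have "pd c (pd Z q) = 0" for c
  proof (cases "c = Z")
    case True
    have "pd Z (pd Zbar r) = 0" using r[of Z] by (simp add: pd_commute[of Z])
    then show ?thesis by (simp add: True qr)
  next
    case False
    then show ?thesis using q by (simp add: pd_commute[of c])
  qed
  then obtain \<gamma> where \<gamma>: "pd Z q = const \<gamma>" by (rule pd_all_0_const)
  have "pd c (q - const \<gamma> * zc) = 0" for c
    using q[of c] \<gamma> by (cases "c = Z") simp_all
  then obtain \<alpha> where \<alpha>: "q - const \<gamma> * zc = const \<alpha>" by (rule pd_all_0_const)
  have "pd c (r + const \<gamma> * cj zc) = 0" for c
    using r[of c] \<gamma> qr by (cases "c = Zbar") (simp_all add: pd_cj)
  then obtain \<beta> where \<beta>: "r + const \<gamma> * cj zc = const \<beta>" by (rule pd_all_0_const)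
  have q': "fn q p = \<alpha> + \<gamma> * z_of p" for p
    using arg_cong[OF \<alpha>, of "\<lambda>F. fn F p"] by (simp add: algebra_simps)
  have r': "fn r p = \<beta> - \<gamma> * cnj (z_of p)" for p
    using arg_cong[OF \<beta>, of "\<lambda>F. fn F p"] by (simp add: algebra_simps)
  have "fn F (z, u, w) = w 0 * (\<alpha> + \<gamma> * z) + cnj (w 0) * (\<beta> - \<gamma> * cnj z)" for z u w
    by (subst F) (simp add: q' r' z_of_def uj_of_def)
  then show ?thesis using that by (simp add: P)
qed

lemma V_trivial:
  assumes d: "\<bar>d\<bar> \<ge> 2" shows "V f d = {\<lambda>_. 0}"
proof
  show "V f d \<subseteq> {\<lambda>_. 0}"
  proof
    fix P assume PV: "P \<in> V f d"
    obtain \<alpha> \<beta> \<gamma> where P: "\<And>z u w. P (z, u, w) = w 0 * (\<alpha> + \<gamma> * z) + cnj (w 0) * (\<beta> - \<gamma> * cnj z)"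
      by (rule V_solution[OF PV]) blast
    have wt: "l * w * (\<alpha> + \<gamma> * (inverse l * z)) + cnj (l * w) * (\<beta> - \<gamma> * cnj (inverse l * z)) =
        l powi d * (w * (\<alpha> + \<gamma> * z) + cnj w * (\<beta> - \<gamma> * cnj z))" if "norm l = 1" for l w z
      using PV that
      unfolding V_def has_weighted_degree_def mem_Collect_eq
      by (elim conjE, drule_tac spec[of _ l], drule_tac spec[of _ z], drule_tac spec[of _ 0], drule_tac spec[of _ "\<lambda>_. w"])
         (simp add: P)
    have inv: "cnj l = inverse l" "l \<noteq> 0" if "norm l = 1" for l :: complex
      using that by (auto simp: inverse_complex_def cmod_def complex_eq_iff)
    \<comment> \<open>At z = 0 the values u_0 = 1 and u_0 = \<i> separate the coefficients of u_0
      and conj u_0.\<close>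
    have lin: "l * \<alpha> = l powi d * \<alpha>" "inverse l * \<beta> = l powi d * \<beta>" if l: "norm l = 1" for l
    proof -
      have 1: "l * \<alpha> + inverse l * \<beta> = l powi d * (\<alpha> + \<beta>)"
        using wt[OF l, of 1 0] inv[OF l] by simp
      have "\<i> * (l * \<alpha> - inverse l * \<beta>) = \<i> * (l powi d * (\<alpha> - \<beta>))"
        using wt[OF l, of \<i> 0] inv[OF l] by (simp add: algebra_simps)
      then have 2: "l * \<alpha> - inverse l * \<beta> = l powi d * (\<alpha> - \<beta>)" by simp
      have "2 * (l * \<alpha>) = 2 * (l powi d * \<alpha>)" "2 * (inverse l * \<beta>) = 2 * (l powi d * \<beta>)"
        using 1 2 by (simp_all add: algebra_simps) algebra+
      then show "l * \<alpha> = l powi d * \<alpha>" "inverse l * \<beta> = l powi d * \<beta>" by simp_all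
    qed
    have nz: "d - 1 \<noteq> 0" "d + 1 \<noteq> 0" "d \<noteq> 0" using d by auto
    have \<alpha>: "\<alpha> = 0"
    proof -
      obtain l :: complex where l: "norm l = 1" "l powi (d - 1) = - 1"
        using ex_unit_powi_minus_1[OF nz(1)] by blast
      have "l powi d = l powi (d - 1) * l"
        using inv(2)[OF l(1)] power_int_add_1[of l "d - 1"] by simp
      then show ?thesis using lin(1)[OF l(1)] inv(2)[OF l(1)] by (simp add: l)
    qed
    have \<beta>: "\<beta> = 0"
    proof -
      obtain l :: complex where l: "norm l = 1" "l powi (d + 1) = - 1"
        using ex_unit_powi_minus_1[OF nz(2)] by blast
      have "l powi d = l powi (d + 1) * inverse l"
        using inv(2)[OF l(1)] power_int_add_1[of l d] by simp
      then show ?thesis using lin(2)[OF l(1)] inv(2)[OF l(1)] by (simp add: l)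
    qed
    have \<gamma>: "\<gamma> = 0"
    proof -
      obtain l :: complex where l: "norm l = 1" "l powi d = - 1"
        using ex_unit_powi_minus_1[OF nz(3)] by blast
      \<comment> \<open>At z = 1, u_0 = \<i> the two \<gamma>-terms add up to 2 \<i> \<gamma>
        instead of cancelling.\<close>
      have "4 * \<i> * \<gamma> = 0"
        using wt[OF l(1), of \<i> 1] inv[OF l(1)] by (simp add: \<alpha> \<beta> l(2) algebra_simps)
      then show ?thesis by simp
    qed
    have "P p = 0" for p by (cases p) (simp add: P \<alpha> \<beta> \<gamma>)
    then show "P \<in> {\<lambda>_. 0}" by auto
  qed
  have z: "fn 0 = (\<lambda>_. 0)" by auto
  have "level 0 0" by simp
  then have "e_minus1_bar f (e_minus1 f (\<lambda>_. 0)) = (\<lambda>_. 0)"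
    using e_minus1_fn[of 0 0] e_minus1_bar_fn[of 0 0] by (simp add: z)
  moreover have "partial c (\<lambda>_. 0) = (\<lambda>_. 0)" for c by (rule ext) (rule partial_const)
  ultimately show "{\<lambda>_. 0} \<subseteq> V f d"
    using smooth_fun_fn[of 0] by (simp add: V_def z has_weighted_degree_def del: partial.simps)
qed

end

section \<open>Contraction of forms\<close>

lemma sum_form_apply: "(\<Sum>x\<in>S. F x) p cs = (\<Sum>x\<in>S. (F x :: form) p cs)"
  by (induction S rule: infinite_finite_induct) auto

lemma cnj_if: "cnj (if b then 1 else 0) = (if b then 1 else 0)"
  by simp

lemma homogeneousD: "homogeneous n \<alpha> \<Longrightarrow> length cs \<noteq> n \<Longrightarrow> \<alpha> p cs = 0"
  unfolding homogeneous_def by blast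

lemma nths_two: "nths [x, y] {} = []" "nths [x, y] {0} = [x]" "nths [x, y] {Suc 0} = [y]"
  "nths [x, y] {0, Suc 0} = [x, y]"
  by (simp_all add: nths_Cons)

lemma wedge_two:
  assumes "homogeneous 1 \<alpha>" "homogeneous 1 \<beta>"
  shows "(\<alpha> \<curlywedge> \<beta>) p [x, y] = \<alpha> p [x] * \<beta> p [y] - \<alpha> p [y] * \<beta> p [x]"
proof -
  have 0: "\<alpha> p [] = 0" "\<beta> p [] = 0" using assms by (simp_all add: homogeneousD)
  have L: "{..<length [x, y]} = {0, Suc 0}" by auto
  have P: "Pow {0, Suc 0} = {{}, {0}, {Suc 0}, {0, Suc 0}}" by auto
  have c: "{(i, j). i = 0 \<and> (j = 0 \<or> j = Suc 0) \<and> 0 < j \<and> j < i} = {}"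
    "{(i, j). i = Suc 0 \<and> (j = 0 \<or> j = Suc 0) \<and> j \<noteq> Suc 0 \<and> j < i} = {(Suc 0, 0)}" by auto
  have d: "{0, Suc 0} - {0} = {Suc 0}" "{0, Suc 0} - {Suc 0} = {0}" by auto
  have ne: "{} \<noteq> {0::nat}" "{} \<noteq> {Suc 0}" "{0} \<noteq> {Suc 0}" "{0} \<noteq> {0, Suc 0}" "{Suc 0} \<noteq> {0, Suc 0}" by auto
  show ?thesis
    unfolding wedge_def L P
    by (simp add: ne 0 nths_two c d)
qed

lemma homogeneous_ops:
  "homogeneous n \<alpha> \<Longrightarrow> homogeneous n \<beta> \<Longrightarrow> homogeneous n (\<alpha> + \<beta>)"
  "homogeneous n \<alpha> \<Longrightarrow> homogeneous n \<beta> \<Longrightarrow> homogeneous n (\<alpha> - \<beta>)"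
  "homogeneous n \<alpha> \<Longrightarrow> homogeneous n (F \<cdot>\<^sub>F \<alpha>)"
  "homogeneous n \<alpha> \<Longrightarrow> homogeneous n (conj_form \<alpha>)"
  by (simp_all add: homogeneous_def scale_def conj_form_def)

lemma homogeneous_d_fn: "homogeneous 1 (ext_d (fn_form F))"
  unfolding homogeneous_def
proof (intro allI impI)
  fix p and cs :: "coord list" assume cs: "length cs \<noteq> 1"
  have "(\<lambda>q. fn_form F q (take i cs @ drop (Suc i) cs)) = (\<lambda>q. 0)" if "i < length cs" for i
  proof -
    have "length (take i cs @ drop (Suc i) cs) \<noteq> 0" using that cs by simp
    then have "take i cs @ drop (Suc i) cs \<noteq> []" by (metis list.size(3))
    then show ?thesis by (simp only: fn_form_def if_False)
  qed
  then show "ext_d (fn_form F) p cs = 0"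
    by (simp add: ext_d_def partial_const del: partial.simps)
qed

lemma d_fn_one: "ext_d (fn_form F) p [c] = partial c F p"
  by (simp add: ext_d_def fn_form_def del: partial.simps)

lemma zeta_one: "zeta p [c] = (if c = Z then 1 else 0)"
proof -
  have "fn zc = z_of" by transfer simp
  then have "zeta p [c] = fn (pd c zc) p" by (simp add: zeta_def d_fn_one del: pd_zc)
  then show ?thesis by simp
qed

lemma d_uj_one: "ext_d (fn_form (uj_of i)) p [c] = (if c = Uj i then 1 else 0)"
proof -
  have "fn (uj i) = uj_of i" by transfer simp
  then have "ext_d (fn_form (uj_of i)) p [c] = fn (pd c (uj i)) p" by (simp add: d_fn_one del: pd_uj)
  then show ?thesis by simp
qed

lemma d_u_one: "ext_d (fn_form (\<lambda>p. of_real (u_of p))) p [c] = (if c = U then 1 else 0)"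
proof -
  have "real_partial c (\<lambda>p. complex_of_real (u_of p)) p = (if c = RealU then 1 else 0)" for c p
    using has_vector_derivative_of_real_comp[of "\<lambda>x. x" p c] by (auto intro!: real_partial_eqI)
  then show ?thesis unfolding d_fn_one by (cases c) auto
qed

lemma zeta_homogeneous: "homogeneous 1 zeta"
  unfolding zeta_def by (rule homogeneous_d_fn)

lemma omega_homogeneous: "homogeneous 1 (omega_Suc f i)"
  unfolding omega_Suc_def by (intro homogeneous_ops homogeneous_d_fn zeta_homogeneous)

lemma eta_homogeneous: "homogeneous 1 (eta f i)"
  by (cases i; simp only: eta.simps;
      intro homogeneous_ops homogeneous_d_fn zeta_homogeneous omega_homogeneous)

lemma omega_one: "omega_Suc f i p [c] = (if c = Uj i then 1 else 0) + (if c = Zbar then T f i p else 0)"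
  by (simp add: omega_Suc_def scale_def conj_form_def zeta_one d_uj_one)

lemma eta_Suc_one: "eta f (Suc i) p [c] =
    (if c = Uj i then 1 else 0) + (if c = Zbar then T f i p else 0) - (if c = Z then uj_of (Suc i) p else 0)"
  by (simp add: scale_def omega_one zeta_one)

lemma eta_0_one: "eta f 0 p [c] =
    (if c = U then 1 else 0) - (if c = Z then uj_of 0 p else 0) - (if c = Zbar then cnj (uj_of 0 p) else 0)"
  by (simp add: scale_def conj_form_def zeta_one d_u_one)

lemma psi_two: "psi f p [x, y] = 1 / (2 * \<i>) *
    ((zeta \<curlywedge> omega_Suc f 0) p [x, y] - cnj ((zeta \<curlywedge> omega_Suc f 0) p [conj_coord x, conj_coord y]))"
  by (simp add: psi_def Im_form_def scale_def conj_form_def)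

section \<open>Contraction of the normal form with e_{-1}\<close>

context poisson
begin

definition contract :: "nat \<Rightarrow> form \<Rightarrow> jet \<Rightarrow> coord list \<Rightarrow> complex" where
  "contract N \<alpha> p cs = (\<Sum>c\<in>coords N. fn (Dv c) p * \<alpha> p (c # cs))"

lemma contract_linear:
  "contract N (\<alpha> + \<beta>) p cs = contract N \<alpha> p cs + contract N \<beta> p cs"
  "contract N (F \<cdot>\<^sub>F \<alpha>) p cs = F p * contract N \<alpha> p cs"
  "contract N (sum G S) p cs = (\<Sum>x\<in>S. contract N (G x) p cs)"
  by (simp_all add: contract_def scale_def algebra_simps sum.distrib sum_distrib_left sum_form_apply)
     (rule sum.swap)

lemma contract_wedge:
  assumes "homogeneous 1 \<alpha>" "homogeneous 1 \<beta>"
  shows "contract N (\<alpha> \<curlywedge> \<beta>) p [y] = contract N \<alpha> p [] * \<beta> p [y] - \<alpha> p [y] * contract N \<beta> p []"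
  unfolding contract_def wedge_two[OF assms]
  by (simp add: algebra_simps sum_subtractf sum_distrib_left sum_distrib_right)

text \<open>Contact forms vanish on a total derivative: the coefficients u_{j+1} and -conj T^j of
  the field cancel the corrections in eta_{j+1} and its conjugate. The bound i \<le> N keeps these
  components inside the truncation.\<close>

lemma contract_eta:
  assumes "i \<le> N" "1 \<le> i"
  shows "contract N (eta f i) p [] = 0" "contract N (conj_form (eta f i)) p [] = 0"
proof -
  obtain j where i: "i = Suc j" "j < N" using assms by (cases i) auto
  show "contract N (eta f i) p [] = 0"
    using i by (simp add: contract_def sum_coords eta_Suc_one mult_delta_right del: eta.simps)
  show "contract N (conj_form (eta f i)) p [] = 0"
    using i by (simp add: contract_def sum_coords eta_Suc_one conj_form_def mult_delta_right fn_Ts cnj_if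
        sum_negf del: eta.simps)
qed

lemma contract_eta_0: "contract N (eta f 0) p [] = 0"
  by (simp add: contract_def sum_coords eta_0_one del: eta.simps)

lemma contract_zeta: "contract N zeta p [] = 1"
  by (simp add: contract_def sum_coords zeta_one)

text \<open>e_{-1} annihilates both conj zeta and conj omega_1, so only zeta with omega_1
  contributes; the result is eta_1 / (2i).\<close>

lemma contract_psi:
  assumes "0 < N"
  shows "contract N (psi f) p [y] = 1 / (2 * \<i>) * (omega_Suc f 0 p [y] - zeta p [y] * uj_of (Suc 0) p)"
proof -
  let ?\<omega> = "omega_Suc f 0"
  have \<omega>: "contract N ?\<omega> p [] = uj_of (Suc 0) p"
    using assms by (simp add: contract_def sum_coords omega_one mult_delta_right)
  have \<omega>b: "contract N (conj_form ?\<omega>) p [] = 0"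
    using assms by (simp add: contract_def sum_coords omega_one conj_form_def mult_delta_right fn_fu cnj_if
        sum_negf)
  have zb: "contract N (conj_form zeta) p [] = 0"
    by (simp add: contract_def sum_coords zeta_one conj_form_def)
  have psi: "psi f p [x, y] = 1 / (2 * \<i>) * ((zeta \<curlywedge> ?\<omega>) p [x, y] - (conj_form zeta \<curlywedge> conj_form ?\<omega>) p [x, y])" for x y
    unfolding psi_two
    by (simp add: wedge_two homogeneous_ops zeta_homogeneous omega_homogeneous conj_form_def del: One_nat_def)
  have "contract N (psi f) p [y] = 1 / (2 * \<i>) *
      (contract N (zeta \<curlywedge> ?\<omega>) p [y] - contract N (conj_form zeta \<curlywedge> conj_form ?\<omega>) p [y])"
    unfolding contract_def psi by (simp add: algebra_simps sum_subtractf sum_distrib_left)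
  then show ?thesis
    by (simp add: contract_wedge homogeneous_ops zeta_homogeneous omega_homogeneous \<omega> \<omega>b zb contract_zeta
        del: One_nat_def)
qed

text \<open>Every term of the two sums is a wedge of contact forms, which the contraction
  annihilates.\<close>

lemma contract_normal_form:
  assumes \<rho>: "homogeneous 1 \<rho>" and N: "k \<le> N" "0 < N"
    and \<Phi>: "\<Phi> = eta f 0 \<curlywedge> \<rho> + A \<cdot>\<^sub>F psi f
          + (\<Sum>(i, j) \<in> {(i, j). 1 \<le> i \<and> i < j \<and> j \<le> k}.
               B i j \<cdot>\<^sub>F (eta f i \<curlywedge> eta f j)
               + (\<lambda>p. cnj (B i j p)) \<cdot>\<^sub>F (conj_form (eta f i) \<curlywedge> conj_form (eta f j)))
          + (\<Sum>(i, j) \<in> {(i, j). 1 \<le> i \<and> i \<le> j \<and> j \<le> k}.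
               C i j \<cdot>\<^sub>F (eta f i \<curlywedge> conj_form (eta f j))
               + (\<lambda>p. cnj (C i j p)) \<cdot>\<^sub>F (conj_form (eta f i) \<curlywedge> eta f j))"
  shows "contract N \<Phi> p [y] = - eta f 0 p [y] * contract N \<rho> p [] +
    A p * (1 / (2 * \<i>) * (omega_Suc f 0 p [y] - zeta p [y] * uj_of (Suc 0) p))"
proof -
  note h = homogeneous_ops eta_homogeneous
  have 1: "contract N (\<Sum>(i, j) \<in> {(i, j). 1 \<le> i \<and> i < j \<and> j \<le> k}.
               B i j \<cdot>\<^sub>F (eta f i \<curlywedge> eta f j)
               + (\<lambda>p. cnj (B i j p)) \<cdot>\<^sub>F (conj_form (eta f i) \<curlywedge> conj_form (eta f j))) p [y] = 0"
    unfolding contract_linear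
    by (rule sum.neutral) (use N in \<open>auto simp: contract_linear contract_wedge h contract_eta simp del: eta.simps One_nat_def\<close>)
  have 2: "contract N (\<Sum>(i, j) \<in> {(i, j). 1 \<le> i \<and> i \<le> j \<and> j \<le> k}.
               C i j \<cdot>\<^sub>F (eta f i \<curlywedge> conj_form (eta f j))
               + (\<lambda>p. cnj (C i j p)) \<cdot>\<^sub>F (conj_form (eta f i) \<curlywedge> eta f j)) p [y] = 0"
    unfolding contract_linear
    by (rule sum.neutral) (use N in \<open>auto simp: contract_linear contract_wedge h contract_eta simp del: eta.simps One_nat_def\<close>)
  show ?thesis
    unfolding \<Phi> contract_linear(1) 1 2
    by (simp add: contract_linear contract_wedge h \<rho> contract_eta_0 contract_psi[OF N(2)] del: eta.simps One_nat_def)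
qed

lemma conservation_laws_classical: "conservation_laws f = conservation_laws_on f 0"
proof
  show "conservation_laws_on f 0 \<subseteq> conservation_laws f" by (auto simp: conservation_laws_on_def)
  show "conservation_laws f \<subseteq> conservation_laws_on f 0"
  proof
    fix \<Phi> assume \<Phi>: "\<Phi> \<in> conservation_laws f"
    then obtain k0 where k0: "form_on k0 \<Phi>" by (auto simp: conservation_laws_def is_form_def)
    from \<Phi> have hom: "homogeneous 2 \<Phi>" and re: "real_form \<Phi>" and cl: "ext_d \<Phi> = 0"
      by (simp_all add: conservation_laws_def)
    from \<Phi> obtain k \<rho> A B C where \<rho>: "homogeneous 1 \<rho>" and A: "smooth_fun A" "\<And>p. A p \<in> \<real>"
      and nf: "\<Phi> = eta f 0 \<curlywedge> \<rho> + A \<cdot>\<^sub>F psi f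
          + (\<Sum>(i, j) \<in> {(i, j). 1 \<le> i \<and> i < j \<and> j \<le> k}.
               B i j \<cdot>\<^sub>F (eta f i \<curlywedge> eta f j)
               + (\<lambda>p. cnj (B i j p)) \<cdot>\<^sub>F (conj_form (eta f i) \<curlywedge> conj_form (eta f j)))
          + (\<Sum>(i, j) \<in> {(i, j). 1 \<le> i \<and> i \<le> j \<and> j \<le> k}.
               C i j \<cdot>\<^sub>F (eta f i \<curlywedge> conj_form (eta f j))
               + (\<lambda>p. cnj (C i j p)) \<cdot>\<^sub>F (conj_form (eta f i) \<curlywedge> eta f j))"
      unfolding conservation_laws_def mem_Collect_eq by (elim conjE exE) blast
    define G where "G x y = Sfun (\<lambda>p. \<Phi> p [x, y])" for x y
    have sm: "smooth_fun_on k0 (\<lambda>p. \<Phi> p cs)" for cs using k0 by (simp add: form_on_def)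
    have G: "fn (G x y) = (\<lambda>p. \<Phi> p [x, y])" for x y
      unfolding G_def by (rule Sfun_inverse) (use sm in \<open>auto simp: smooth_fun_def\<close>)
    \<comment> \<open>The factor 1 / (2i) comes from the imaginary part in \<open>psi\<close> and
      makes \<open>a\<close> imaginary for real A.\<close>
    define a where "a = const (1 / (2 * \<i>)) * Sfun A"
    have fA: "fn (Sfun A) = A" by (rule Sfun_inverse) (simp add: A)
    obtain ka where ka: "level ka a" by (rule ex_level)
    define K where "K = max (Suc k0) ka"
    \<comment> \<open>Large enough for the component recursion, K + 3 \<le> N, and for the contact
      forms of the normal form, k \<le> N.\<close>
    define N where "N = K + k + 3"
    have anti: "G x y = - G y x" for x y
    proof (rule sfun_eqI)
      fix p
      have "\<forall>cs i j. i < j \<and> j < length cs \<longrightarrow> \<Phi> p (cs[i := cs ! j, j := cs ! i]) = - \<Phi> p cs"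
        using k0 unfolding form_on_def by blast
      from this[rule_format, of 0 1 "[y, x]"] show "fn (G x y) p = fn (- G y x) p"
        by (simp add: G)
    qed
    have closed: "pd x (G y z) - pd y (G x z) + pd z (G x y) = 0" for x y z
    proof (rule sfun_eqI)
      fix p
      have "ext_d \<Phi> p [x, y, z] = 0" by (simp add: cl)
      then show "fn (pd x (G y z) - pd y (G x z) + pd z (G x y)) p = fn 0 p"
        by (simp add: ext_d_def lessThan_Suc G algebra_simps del: partial.simps)
    qed
    have real: "cj (G x y) = G (conj_coord x) (conj_coord y)" for x y
    proof (rule sfun_eqI)
      fix p
      have "conj_form \<Phi> p [conj_coord x, conj_coord y] = \<Phi> p [conj_coord x, conj_coord y]"
        using re by (simp add: real_form_def)
      then show "fn (cj (G x y)) p = fn (G (conj_coord x) (conj_coord y)) p"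
        by (simp add: conj_form_def G)
    qed
    have vanish: "G (Uj j) y = 0" if "K \<le> j" for j y
    proof (rule sfun_eqI)
      fix p
      have "\<not> coord_on k0 (Uj j)" using that by (simp add: K_def)
      then have "\<Phi> p [Uj j, y] = 0" using k0 unfolding form_on_def by (metis list.set_intros(1))
      then show "fn (G (Uj j) y) p = fn 0 p" by (simp add: G)
    qed
    have lev: "level K a" using level_mono[OF ka] by (simp add: K_def)
    have imag: "cj a = - a"
    proof (rule sfun_eqI)
      fix p
      have "cnj (A p) = A p" using A(2)[of p] by (simp add: Reals_cnj_iff)
      then show "fn (cj a) p = fn (- a) p" by (simp add: a_def fA)
    qed
    have NK: "K + 3 \<le> N" "k \<le> N" "0 < N" by (simp_all add: N_def)
    define iD where "iD y = (\<Sum>c\<in>coords N. Dv c * G c y)" for y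
    have iD: "fn (iD y) p = - eta f 0 p [y] * contract N \<rho> p [] +
        fn a p * (omega_Suc f 0 p [y] - zeta p [y] * uj_of (Suc 0) p)" for y p
    proof -
      have "fn (iD y) p = contract N \<Phi> p [y]" by (simp add: iD_def contract_def G)
      then show ?thesis
        unfolding contract_normal_form[OF \<rho> NK(2,3) nf] by (simp add: a_def fA mult_ac del: eta.simps)
    qed
    have iD_Uj: "iD (Uj j) = (if j = 0 then a else 0)" for j
      by (rule sfun_eqI) (simp add: iD eta_0_one omega_one zeta_one del: eta.simps)
    have iD_Ujbar: "iD (Ujbar j) = 0" for j
      by (rule sfun_eqI) (simp add: iD eta_0_one omega_one zeta_one del: eta.simps)
    \<comment> \<open>The conjugate field annihilates eta_0 and eta_1 too, the only forms left after
      the first contraction.\<close>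
    have iD_Db: "(\<Sum>y\<in>coords N. Dbv y * iD y) = 0"
      by (rule sfun_eqI) (use NK in \<open>simp add: sum_coords iD_Uj iD_Ujbar iD eta_0_one omega_one zeta_one fn_fu
        mult_delta_right algebra_simps del: eta.simps\<close>)
    have Gj: "G (Uj (Suc j)) y = 0" for j y
      by (rule G_higher_vanish[OF anti closed real vanish lev NK(1) imag
            iD_Uj[unfolded iD_def] iD_Ujbar[unfolded iD_def] iD_Db[unfolded iD_def]])
    have Gjb: "G (Ujbar (Suc j)) y = 0" for j y
      using real[of "Uj (Suc j)" "conj_coord y"] Gj by simp
    have Gc: "G x y = 0" if "\<not> coord_on 0 x \<or> \<not> coord_on 0 y" for x y
    proof -
      have *: "G x y = 0" if "\<not> coord_on 0 x" for x y
        using that Gj Gjb by (cases x) (auto simp: gr0_conv_Suc)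
      then show ?thesis using that anti[of x y] *[of y x] by auto
    qed
    have dG: "pd c (G x y) = 0" if "\<not> coord_on 0 c" for c x y
      using closed[of c x y] that by (simp add: Gc)
    have "form_on 0 \<Phi>"
      unfolding form_on_def
    proof (intro conjI allI impI)
      show "\<Phi> p (cs[i := cs ! j, j := cs ! i]) = - \<Phi> p cs" if "i < j \<and> j < length cs" for p cs i j
        using k0 that unfolding form_on_def by blast
      show "\<Phi> p cs = 0" if "\<exists>c\<in>set cs. \<not> coord_on 0 c" for p cs
      proof (cases "length cs = 2")
        case True
        then obtain x y where cs: "cs = [x, y]" by (auto simp: length_Suc_conv numeral_2_eq_2)
        then have "G x y = 0" using that by (intro Gc) auto
        then show ?thesis using G[of x y] by (simp add: cs fun_eq_iff del: split_paired_All)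
      qed (use hom in \<open>simp add: homogeneousD\<close>)
      show "smooth_fun_on 0 (\<lambda>p. \<Phi> p cs)" for cs
      proof (cases "length cs = 2")
        case True
        then obtain x y where cs: "cs = [x, y]" by (auto simp: length_Suc_conv numeral_2_eq_2)
        have "depends_upto 0 (fn (G x y))"
          unfolding depends_upto_def
        proof (intro allI impI)
          fix z u and v w :: "nat \<Rightarrow> complex" assume vw: "\<forall>j\<le>0. v j = w j"
          have "fn (pd c (G x y)) p = 0" if "\<not> coord_on 0 c" for c p
            using dG[OF that] by simp
          then have "partial c (fn (G x y)) p = 0" if "\<not> coord_on 0 c" for c p
            using that by simp
          then show "fn (G x y) (z, u, v) = fn (G x y) (z, u, w)"
            using vw by (intro partial_Uj_0_depends[of _ 1]) (simp_all del: partial.simps)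
        qed
        then show ?thesis
          using sm[of cs] unfolding smooth_fun_on_iff by (simp add: cs G)
      next
        case False
        then have "(\<lambda>p. \<Phi> p cs) = (\<lambda>p. 0)" using hom by (simp add: homogeneousD)
        then show ?thesis by (simp add: smooth_fun_on_const)
      qed
    qed
    then show "\<Phi> \<in> conservation_laws_on f 0" using \<Phi> by (simp add: conservation_laws_on_def)
  qed
qed

end

theorem theorem9p1:
  fixes f :: "real \<Rightarrow> real"
  assumes smooth: "\<forall>n x. ((deriv ^^ n) f) differentiable (at x)"
    and independent: "\<forall>a b c :: real.
      (\<forall>u. a * f u + b * deriv f u + c * deriv (deriv f) u = 0) \<longrightarrow> a = 0 \<and> b = 0 \<and> c = 0"
  shows "(\<forall>d :: int. \<bar>d\<bar> \<ge> 2 \<longrightarrow> V f d = {\<lambda>_. 0}) \<and>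
    conservation_laws f = conservation_laws_on f 0"
proof -
  interpret poisson f
    by standard (use smooth independent in blast)+
  show ?thesis using V_trivial conservation_laws_classical by blast
qed

end
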